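(* Let $r>0$ be a fixed integer, let $n=(10\,\ell\log\ell)^{r+1}$ and $p=\frac{3}{10}(10\,\ell\log\ell)^{-r}$, let $G=G_{n,p}=(V,E)$, and let $v\in V$. Then $U_r(v,G)$ is $2$-degenerate with probability at least $0.99-o(1)$, where $o(1)$ denotes a quantity tending to $0$ as $\ell\to\infty$.
   Context: Graphs are finite, simple and undirected. $G_{n,p}$ is the Erdős–Rényi random graph on $n$ labelled vertices in which each edge is included independently with probability $p$; non-integral $n$ is to be rounded down to an integer. For a graph $G=(V,E)$, $v\in V$ and a positive integer $r$, the $r$-ball $U_r(v,G)$ is the subgraph of $G$ induced on all vertices at graph distance at most $r$ from $v$. A graph is $k$-degenerate if the minimum degree of every subgraph of it is at most $k$. $\log$ is the natural logarithm; $\ell$ is a positive integer tending to infinity. *)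

theory Defs
  imports "HOL-Probability.Probability" "HOL-Library.Extended_Nat"
begin

type_synonym 'a sgraph = "'a set \<times> 'a set set"

abbreviation verts :: "'a sgraph \<Rightarrow> 'a set" where "verts G \<equiv> fst G"
abbreviation edges :: "'a sgraph \<Rightarrow> 'a set set" where "edges G \<equiv> snd G"

definition all_pairs :: "'a set \<Rightarrow> 'a set set" where
  "all_pairs V = {e. e \<subseteq> V \<and> card e = 2}"

definition simple_graph :: "'a sgraph \<Rightarrow> bool" where
  "simple_graph G \<longleftrightarrow> finite (verts G) \<and> edges G \<subseteq> all_pairs (verts G)"

definition subgraph :: "'a sgraph \<Rightarrow> 'a sgraph \<Rightarrow> bool" where
  "subgraph H G \<longleftrightarrow> simple_graph H \<and> verts H \<subseteq> verts G \<and> edges H \<subseteq> edges G"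

definition induced_subgraph :: "'a sgraph \<Rightarrow> 'a set \<Rightarrow> 'a sgraph" where
  "induced_subgraph G S = (verts G \<inter> S, {e \<in> edges G. e \<subseteq> S})"

definition vdegree :: "'a sgraph \<Rightarrow> 'a \<Rightarrow> nat" where
  "vdegree G v = card {e \<in> edges G. v \<in> e}"

definition min_degree :: "'a sgraph \<Rightarrow> nat" where
  "min_degree G = Min (vdegree G ` verts G)"

text \<open>The minimum degree of the graph without vertices is undefined, so only subgraphs with a
  nonempty vertex set are considered.\<close>

definition degenerate :: "nat \<Rightarrow> 'a sgraph \<Rightarrow> bool" where
  "degenerate k G \<longleftrightarrow> (\<forall>H. subgraph H G \<and> verts H \<noteq> {} \<longrightarrow> min_degree H \<le> k)"

definition walk :: "'a sgraph \<Rightarrow> 'a list \<Rightarrow> bool" where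
  "walk G xs \<longleftrightarrow> xs \<noteq> [] \<and> set xs \<subseteq> verts G \<and> successively (\<lambda>x y. {x, y} \<in> edges G) xs"

text \<open>Walks are listed by their vertices, so a walk has one edge less than its list has entries.
  The distance of vertices in different components is \<open>\<infinity>\<close>, the infimum of the empty set.\<close>

definition graph_dist :: "'a sgraph \<Rightarrow> 'a \<Rightarrow> 'a \<Rightarrow> enat" where
  "graph_dist G u v = (INF xs \<in> {xs. walk G xs \<and> hd xs = u \<and> last xs = v}. enat (length xs - 1))"

definition graph_ball :: "nat \<Rightarrow> 'a \<Rightarrow> 'a sgraph \<Rightarrow> 'a sgraph" where
  "graph_ball r v G = induced_subgraph G {w \<in> verts G. graph_dist G v w \<le> enat r}"

text \<open>The vertex set is \<open>{..<n}\<close>. The parameter \<open>p\<close> is meant to lie in \<open>{0..1}\<close>;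
  \<^const>\<open>bernoulli_pmf\<close> clips other values to that interval.\<close>

definition erdos_renyi :: "nat \<Rightarrow> real \<Rightarrow> nat sgraph pmf" where
  "erdos_renyi n p =
     map_pmf (\<lambda>f. ({..<n}, {e \<in> all_pairs {..<n}. f e}))
       (Pi_pmf (all_pairs {..<n}) False (\<lambda>_. bernoulli_pmf p))"

end

theory Submission imports Defs begin

text \<open>
  Write \<open>N = 10 l log l\<close>, so that the expected degree is at most \<open>\<mu> = 3 N / 10\<close>. With high probability
  all degrees are at most \<open>(1 + \<delta>) \<mu>\<close>, hence the ball of radius \<open>r\<close> has at most \<open>M\<close> vertices, where
  \<open>M\<close> is about \<open>(1 + \<delta>)\<^sup>r (3 N / 10)\<^sup>r\<close>, and \<open>M p\<close> is at most about \<open>(3 / 10)\<^sup>r\<^sup>+\<^sup>1\<close>. The ball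
  consists of its breadth-first search tree \<open>T\<close>, of height at most \<open>r\<close>, and of further edges, which behave
  like a subcritical random graph \<open>R\<close> on at most \<open>M\<close> vertices.

  Suppose that the ball has a subgraph of minimum degree at least three. Let \<open>A\<close> and \<open>W\<close> be the sets of
  its vertices which are incident with at least two, respectively exactly one, of its edges outside \<open>T\<close>.
  A vertex without children in the subgraph belongs to \<open>A\<close>, since it has at most one edge in \<open>T\<close>; hence
  each vertex of \<open>W\<close> is an ancestor of a vertex of \<open>A\<close>, and it is not the root, all of whose edges belong to
  \<open>T\<close>. If \<open>W\<close> has at most one element, then \<open>R\<close> contains a cycle. The expected number of cycles is at most
  \<open>\<Sum>\<^sub>k\<^sub>\<ge>\<^sub>3 (M p)\<^sup>k\<close>, which is below \<open>1 / 500\<close>; this is the only one of the bounds that does not tend to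
  zero. Otherwise the degree sum gives at least \<open>|A| + \<lceil>|W| / 2\<rceil>\<close> edges of \<open>R\<close> on \<open>A \<union> W\<close>. Choosing
  \<open>A\<close> costs a factor \<open>M\<^sup>|\<^sup>A\<^sup>| / |A|!\<close>, choosing \<open>W\<close> among the ancestors only \<open>2\<^sup>(\<^sup>r\<^sup>-\<^sup>1\<^sup>)\<^sup>|\<^sup>A\<^sup>|\<close>, and the
  \<open>|A| + \<lceil>|W| / 2\<rceil>\<close> edges contribute at least one factor \<open>p\<close> more than there are vertices in \<open>A\<close>.
  Summed over all cardinalities this is \<open>O(1 / M)\<close>.

  The independence of \<open>R\<close> from \<open>T\<close> is used in the following form. Deleting a set \<open>F\<close> of edges outside the
  tree changes neither the ball nor its tree (\<open>delete_non_tree_edges\<close>), and it divides the probability of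
  the graph by \<open>(p / (1 - p))\<^sup>|\<^sup>F\<^sup>|\<close>. So the union bound over a family of such sets \<open>F\<close> is valid even though the
  family depends on the tree (\<open>sum_weight_deletion\<close>). The deterministic part of the argument is
  \<open>dense_structure\<close>, and the two first moment bounds are \<open>sum_cyclic_le\<close> and \<open>sum_leafy_le\<close>.
\<close>

section \<open>Graphs of minimum degree three on a spanning tree\<close>

text \<open>The edges between consecutive entries of a list of vertices, and those of the closed walk that
  also joins the two ends.\<close>

fun path_edges :: "'a list \<Rightarrow> 'a set set" where
  "path_edges (x # y # zs) = insert {x, y} (path_edges (y # zs))"
| "path_edges _ = {}"

definition cycle_edges :: "'a list \<Rightarrow> 'a set set" where
  "cycle_edges xs = insert {hd xs, last xs} (path_edges xs)"

lemma finite_path_edges [simp]: "finite (path_edges xs)"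
  by (induction xs rule: path_edges.induct) auto

lemma path_edges_subset: "e \<in> path_edges xs \<Longrightarrow> e \<subseteq> set xs"
  by (induction xs rule: path_edges.induct) auto

lemma card_path_edges: "distinct xs \<Longrightarrow> card (path_edges xs) = length xs - 1"
proof (induction xs rule: path_edges.induct)
  case (1 x y zs)
  have "{x, y} \<notin> path_edges (y # zs)"
    using 1(2) path_edges_subset[of "{x, y}" "y # zs"] by auto
  then show ?case using 1 by simp
qed auto

lemma card_cycle_edges:
  assumes "distinct xs" "3 \<le> length xs"
  shows "card (cycle_edges xs) = length xs"
proof -
  obtain x y z zs where xs: "xs = x # y # z # zs"
    using assms(2) by (cases xs rule: path_edges.cases) (auto simp: neq_Nil_conv Suc_le_length_iff numeral_3_eq_3)
  have "{hd xs, last xs} \<notin> path_edges xs"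
  proof
    assume "{hd xs, last xs} \<in> path_edges xs"
    moreover have "last xs \<in> set (z # zs)" using xs by simp
    ultimately show False
      using assms(1) xs path_edges_subset[of "{hd xs, last xs}" "y # z # zs"]
      by (auto simp: doubleton_eq_iff simp del: last.simps split: if_splits)
  qed
  then show ?thesis using card_path_edges[OF assms(1)] assms(2) by (simp add: cycle_edges_def)
qed

lemma path_edges_snoc: "path_edges (xs @ [y, x]) = insert {x, y} (path_edges (xs @ [y]))"
  by (induction xs rule: path_edges.induct) (auto simp: insert_commute)

lemma path_edges_rev: "path_edges (rev xs) = path_edges xs"
proof (induction xs rule: path_edges.induct)
  case (1 x y zs)
  then show ?case using path_edges_snoc[of "rev zs" y x] by simp
qed auto

lemma path_edges_append_subset: "path_edges xs \<subseteq> path_edges (xs @ ys)"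
  by (induction xs rule: path_edges.induct) auto

lemma all_pairsE:
  assumes "e \<in> all_pairs S" obtains x y where "e = {x, y}" "x \<noteq> y" "x \<in> S" "y \<in> S"
  using assms unfolding all_pairs_def card_2_iff by auto

lemma finite_all_pairs [simp]: "finite S \<Longrightarrow> finite (all_pairs S)"
  unfolding all_pairs_def by simp

text \<open>The proof extends a longest path: of its two ends, one is not of degree one, and the second edge
  at that end must lead back into the path.\<close>

lemma exists_cycle:
  assumes fin: "finite S" and F: "F \<subseteq> all_pairs S" "F \<noteq> {}"
    and leaves: "card {x \<in> S. card {e \<in> F. x \<in> e} = 1} \<le> 1"
  obtains xs where "distinct xs" "3 \<le> length xs" "set xs \<subseteq> S" "cycle_edges xs \<subseteq> F"
proof -
  define P where "P xs \<longleftrightarrow> distinct xs \<and> set xs \<subseteq> S \<and> path_edges xs \<subseteq> F \<and> 2 \<le> length xs" for xs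
  obtain e where e: "e \<in> F" using F by blast
  then obtain a b where ab: "e = {a, b}" "a \<noteq> b" "a \<in> S" "b \<in> S"
    using F(1) by (meson all_pairsE subsetD)
  have "P [a, b]" using ab e by (simp add: P_def)
  moreover have "length xs \<le> card S" if "P xs" for xs
    using that fin unfolding P_def by (metis card_mono distinct_card)
  ultimately obtain ps where ps: "P ps" "\<And>xs. P xs \<Longrightarrow> length xs \<le> length ps"
    using ex_has_greatest_nat[of P "[a, b]" length "Suc (card S)"] by (auto simp: less_Suc_eq_le)
  have hd_last: "hd ps \<noteq> last ps" "hd ps \<in> S" "last ps \<in> S"
  proof -
    obtain x y zs where "ps = x # y # zs"
      using ps(1) by (cases ps rule: path_edges.cases) (auto simp: P_def)
    then show "hd ps \<noteq> last ps" "hd ps \<in> S" "last ps \<in> S" using ps(1) by (auto simp: P_def)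
  qed
  have Prev: "P (rev ps)" using ps(1) by (simp add: P_def path_edges_rev)
  have "\<not> (card {e \<in> F. hd ps \<in> e} = 1 \<and> card {e \<in> F. last ps \<in> e} = 1)"
  proof
    assume "card {e \<in> F. hd ps \<in> e} = 1 \<and> card {e \<in> F. last ps \<in> e} = 1"
    then have "card {hd ps, last ps} \<le> card {x \<in> S. card {e \<in> F. x \<in> e} = 1}"
      using fin hd_last by (intro card_mono) auto
    then show False using leaves hd_last by simp
  qed
  then obtain qs where qs: "P qs" "length qs = length ps" "card {e \<in> F. hd qs \<in> e} \<noteq> 1"
  proof (cases "card {e \<in> F. hd ps \<in> e} = 1")
    case True
    then have "card {e \<in> F. hd (rev ps) \<in> e} \<noteq> 1"
      using \<open>\<not> (_ \<and> _)\<close> by (simp add: hd_rev)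
    then show ?thesis using that[of "rev ps"] Prev by simp
  qed (use that[of ps] ps(1) in simp)
  obtain x y zs where xyz: "qs = x # y # zs"
    using qs(1) by (cases qs rule: path_edges.cases) (auto simp: P_def)
  have xy: "{x, y} \<in> F" using qs(1) xyz by (simp add: P_def)
  have "\<exists>f \<in> F. x \<in> f \<and> f \<noteq> {x, y}"
  proof (rule ccontr)
    assume "\<not> ?thesis"
    then have "{e \<in> F. x \<in> e} = {{x, y}}" using xy by blast
    then show False using qs(3) xyz by simp
  qed
  then obtain f where f: "f \<in> F" "x \<in> f" "f \<noteq> {x, y}" by blast
  then obtain z where z: "f = {x, z}" "z \<noteq> x" "z \<in> S"
  proof -
    obtain s t where "f = {s, t}" "s \<noteq> t" "s \<in> S" "t \<in> S"
      using F(1) f(1) by (meson all_pairsE subsetD)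
    then show ?thesis using that[of s] that[of t] f(2) by auto
  qed
  have "z \<in> set qs"
  proof (rule ccontr)
    assume "z \<notin> set qs"
    then have "P (z # qs)"
      using qs(1) z f xyz by (auto simp: P_def insert_commute)
    then show False using ps(2)[of "z # qs"] qs(2) by simp
  qed
  then have "z \<in> set zs" using z f xyz by auto
  then obtain us vs where uv: "zs = us @ z # vs" by (meson split_list)
  define cs where "cs = x # y # us @ [z]"
  have cs: "qs = cs @ vs" using xyz uv by (simp add: cs_def)
  have "path_edges cs \<subseteq> F"
    using path_edges_append_subset[of cs vs] qs(1) cs by (auto simp: P_def)
  then have "cycle_edges cs \<subseteq> F" using f z by (simp add: cycle_edges_def cs_def)
  moreover have "distinct cs" "set cs \<subseteq> S" "3 \<le> length cs"
    using qs(1) cs by (auto simp: P_def cs_def)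
  ultimately show ?thesis using that by blast
qed

lemma sum_degrees:
  assumes "finite S" "F \<subseteq> all_pairs S"
  shows "(\<Sum>x\<in>S. card {e \<in> F. x \<in> e}) = 2 * card F"
proof -
  have finF: "finite F" using finite_subset[OF assms(2)] assms(1) by simp
  have "(\<Sum>x\<in>S. card {e \<in> F. x \<in> e}) = (\<Sum>x\<in>S. \<Sum>e\<in>F. if x \<in> e then 1 else 0)"
    using finF by (simp add: sum.If_cases Int_def)
  also have "\<dots> = (\<Sum>e\<in>F. \<Sum>x\<in>S. if x \<in> e then 1 else 0)" by (rule sum.swap)
  also have "\<dots> = (\<Sum>e\<in>F. 2)"
  proof (rule sum.cong)
    fix e assume "e \<in> F"
    then have "e \<subseteq> S" "card e = 2" using assms(2) by (auto simp: all_pairs_def)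
    then show "(\<Sum>x\<in>S. if x \<in> e then 1 else 0) = (2::nat)"
      using assms(1) by (simp add: sum.If_cases Int_absorb1)
  qed simp
  finally show ?thesis by simp
qed

text \<open>A tree with vertex set \<open>B\<close> and root \<open>v\<close> is given by its parent function \<open>\<pi>\<close>, whose values
  on \<open>v\<close> and outside \<open>B\<close> do not matter here.\<close>

definition tree_edges :: "'a set \<Rightarrow> 'a \<Rightarrow> ('a \<Rightarrow> 'a) \<Rightarrow> 'a set set" where
  "tree_edges B v \<pi> = (\<lambda>x. {x, \<pi> x}) ` (B - {v})"

text \<open>In a tree of height at most \<open>r\<close> this set contains the proper ancestors of \<open>x\<close> other than the
  root, and it has at most \<open>r - 1\<close> elements whatever the depth of \<open>x\<close> is. Not having to provide for the root
  makes a difference: the factor \<open>2 ^ (r - 1)\<close> that results in the first moment bound is just small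
  enough, and for \<open>r = 1\<close> there are no ancestors at all.\<close>

definition ancestors :: "nat \<Rightarrow> ('a \<Rightarrow> 'a) \<Rightarrow> 'a \<Rightarrow> 'a set" where
  "ancestors r \<pi> x = (\<lambda>i. (\<pi> ^^ i) x) ` {1..<r}"

text \<open>The edge sets that a subgraph of minimum degree three forces when it contains no cycle outside the
  tree. Here \<open>A\<close> stands for vertices of degree at least two and
  \<open>W\<close> for vertices of degree one; the degree sum then forces at least \<open>card A + card W / 2\<close> edges, and
  \<open>F\<close> has exactly as many, rounded up. Since every element of \<open>W\<close> is an ancestor of one of \<open>A\<close>, it
  has only boundedly many possible positions once \<open>A\<close> is given.\<close>

definition leafy :: "nat \<Rightarrow> 'a set \<Rightarrow> ('a \<Rightarrow> 'a) \<Rightarrow> 'a set set \<Rightarrow> bool" where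
  "leafy r B \<pi> F \<longleftrightarrow> (\<exists>A W. A \<subseteq> B \<and> W \<subseteq> B \<and> A \<noteq> {} \<and> A \<inter> W = {} \<and> W \<subseteq> (\<Union>a\<in>A. ancestors r \<pi> a)
     \<and> 2 \<le> card W \<and> F \<subseteq> all_pairs (A \<union> W) \<and> card F = card A + (card W + 1) div 2)"

text \<open>The edge sets of cycles in \<open>B\<close>.\<close>

definition cyclic :: "'a set \<Rightarrow> 'a set set \<Rightarrow> bool" where
  "cyclic B F \<longleftrightarrow> (\<exists>xs. distinct xs \<and> 3 \<le> length xs \<and> set xs \<subseteq> B \<and> F = cycle_edges xs)"

text \<open>The deterministic core. In a graph \<open>D\<close> of minimum degree at least three, a vertex without
  children in the graph loses at most one tree edge, so it keeps degree at least two when the tree edges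
  are removed. Hence a vertex that keeps only degree one has a child in \<open>D\<close>, and following children
  downwards leads from it to a vertex that keeps degree at least two.\<close>

lemma dense_structure:
  assumes finB: "finite B"
    and root: "\<And>x. x \<in> B \<Longrightarrow> lev x = 0 \<longleftrightarrow> x = v"
    and lev_par: "\<And>x. x \<in> B \<Longrightarrow> x \<noteq> v \<Longrightarrow> lev x = Suc (lev (\<pi> x))"
    and height: "\<And>x. x \<in> B \<Longrightarrow> lev x \<le> r"
    and S: "S \<subseteq> B" "S \<noteq> {}" and D: "D \<subseteq> all_pairs S"
    and D_root: "\<And>e. e \<in> D \<Longrightarrow> v \<in> e \<Longrightarrow> e \<in> tree_edges B v \<pi>"
    and deg: "\<And>x. x \<in> S \<Longrightarrow> 3 \<le> card {e \<in> D. x \<in> e}"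
  shows "\<exists>F \<subseteq> D - tree_edges B v \<pi>. cyclic B F \<or> leafy r B \<pi> F"
proof -
  define F where "F = D - tree_edges B v \<pi>"
  define dg where "dg x = card {e \<in> F. x \<in> e}" for x
  define A where "A = {x \<in> S. 2 \<le> dg x}"
  define W where "W = {x \<in> S. dg x = 1}"
  have finS: "finite S" using finB S finite_subset by blast
  have finD: "finite D" using D finS finite_subset by fastforce
  have FS: "F \<subseteq> all_pairs S" using D by (auto simp: F_def)
  have finF: "finite F" using finD by (simp add: F_def)
  have childless: "2 \<le> dg x" if x: "x \<in> S" and nochild: "\<And>y. y \<in> S \<Longrightarrow> y \<noteq> v \<Longrightarrow> \<pi> y \<noteq> x" for x
  proof -
    have "{e \<in> D. x \<in> e} \<subseteq> insert {x, \<pi> x} {e \<in> F. x \<in> e}"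
    proof
      fix e assume e: "e \<in> {e \<in> D. x \<in> e}"
      show "e \<in> insert {x, \<pi> x} {e \<in> F. x \<in> e}"
      proof (cases "e \<in> tree_edges B v \<pi>")
        case True
        then obtain y where y: "y \<in> B - {v}" "e = {y, \<pi> y}" by (auto simp: tree_edges_def)
        have "y \<in> S" using e D y by (auto simp: all_pairs_def)
        then show ?thesis using y e nochild[of y] by auto
      qed (use e in \<open>auto simp: F_def\<close>)
    qed
    then have "card {e \<in> D. x \<in> e} \<le> card (insert {x, \<pi> x} {e \<in> F. x \<in> e})"
      using finF by (intro card_mono) auto
    also have "\<dots> \<le> Suc (dg x)" unfolding dg_def using finF by (simp add: card_insert_if)
    finally show ?thesis using deg[OF x] by simp
  qed
  have anc: "\<exists>a\<in>A. w \<in> ancestors r \<pi> a" if w: "w \<in> W" for w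
  proof -
    \<comment> \<open>\<open>Q\<close> describes the descendants of \<open>w\<close> in \<open>S\<close>; one of maximal level has no children in \<open>S\<close>.\<close>
    define Q where "Q x \<longleftrightarrow> x \<in> S \<and> (\<exists>i. (\<pi> ^^ i) x = w \<and> lev x = lev w + i)" for x
    have wS: "w \<in> S" using w by (simp add: W_def)
    have "Q w" using wS by (auto simp: Q_def intro!: exI[of _ 0])
    moreover have "\<And>x. Q x \<Longrightarrow> lev x \<le> r" using height S by (auto simp: Q_def)
    ultimately obtain a where a: "Q a" "\<And>x. Q x \<Longrightarrow> lev x \<le> lev a"
      using ex_has_greatest_nat[of Q w lev "Suc r"] by (auto simp: less_Suc_eq_le)
    obtain i where i: "(\<pi> ^^ i) a = w" "lev a = lev w + i" "a \<in> S" using a by (auto simp: Q_def)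
    have "\<pi> y \<noteq> a" if y: "y \<in> S" "y \<noteq> v" for y
    proof
      assume eq: "\<pi> y = a"
      then have l: "lev y = Suc (lev a)" using y S lev_par by auto
      have "Q y" unfolding Q_def
        using y eq i l by (auto intro!: exI[of _ "Suc i"] simp: funpow_Suc_right simp del: funpow.simps)
      then show False using a(2) l by fastforce
    qed
    then have "2 \<le> dg a" using childless i by blast
    then have aA: "a \<in> A" using i by (simp add: A_def)
    have "dg w = 1" using w by (simp add: W_def)
    then have "i \<noteq> 0" using i \<open>2 \<le> dg a\<close> by (intro notI) simp
    have "w \<noteq> v"
    proof
      assume "w = v"
      then have "{e \<in> F. w \<in> e} = {}" using D_root by (auto simp: F_def)
      then show False using \<open>dg w = 1\<close> unfolding dg_def by (metis card.empty zero_neq_one)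
    qed
    then have "lev w \<noteq> 0" using root wS S by auto
    moreover have "lev a \<le> r" using height i(3) S by blast
    ultimately have "i \<in> {1..<r}" using i \<open>i \<noteq> 0\<close> by auto
    then show ?thesis using aA i(1) unfolding ancestors_def by (intro bexI[of _ a] image_eqI[of _ _ i]) auto
  qed
  have A_ne: "A \<noteq> {}"
  proof -
    obtain s where s: "s \<in> S" using S by blast
    obtain a where a: "a \<in> S" "\<And>x. x \<in> S \<Longrightarrow> lev x \<le> lev a"
      using ex_has_greatest_nat[of "\<lambda>x. x \<in> S" s lev "Suc r"] height S s by (auto simp: less_Suc_eq_le subset_iff)
    have "\<pi> y \<noteq> a" if "y \<in> S" "y \<noteq> v" for y
      using that a(2)[of y] lev_par[of y] S by auto
    then have "a \<in> A" using childless a by (auto simp: A_def)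
    then show ?thesis by blast
  qed
  then have F_ne: "F \<noteq> {}" by (auto simp: A_def dg_def)
  have F_AW: "F \<subseteq> all_pairs (A \<union> W)"
  proof
    fix e assume e: "e \<in> F"
    have "x \<in> A \<union> W" if "x \<in> e" for x
    proof -
      have "x \<in> S" using e FS that by (auto simp: all_pairs_def)
      moreover have "dg x \<noteq> 0" using e that finF by (auto simp: dg_def)
      ultimately show ?thesis by (auto simp: A_def W_def)
    qed
    then show "e \<in> all_pairs (A \<union> W)" using e FS by (auto simp: all_pairs_def)
  qed
  show ?thesis
  proof (cases "card W \<le> 1")
    case True
    then obtain xs where "distinct xs" "3 \<le> length xs" "set xs \<subseteq> S" "cycle_edges xs \<subseteq> F"
      using exists_cycle[OF finS FS F_ne] by (auto simp: W_def dg_def)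
    then have "cyclic B (cycle_edges xs)" "cycle_edges xs \<subseteq> D - tree_edges B v \<pi>"
      using S unfolding cyclic_def F_def by blast+
    then show ?thesis by blast
  next
    case False
    have "2 * card A + card W = (\<Sum>x\<in>A. 2) + (\<Sum>x\<in>W. 1)" by simp
    also have "\<dots> \<le> (\<Sum>x\<in>A. dg x) + (\<Sum>x\<in>W. dg x)"
      by (intro add_mono sum_mono) (auto simp: A_def W_def)
    also have "\<dots> = (\<Sum>x\<in>A \<union> W. dg x)"
      using finS by (intro sum.union_disjoint[symmetric]) (auto simp: A_def W_def)
    also have "\<dots> \<le> (\<Sum>x\<in>S. dg x)" using finS by (intro sum_mono2) (auto simp: A_def W_def)
    also have "\<dots> = 2 * card F" using sum_degrees[OF finS FS] by (simp add: dg_def)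
    finally have "card A + (card W + 1) div 2 \<le> card F" by simp
    then obtain F0 where F0: "F0 \<subseteq> F" "card F0 = card A + (card W + 1) div 2"
      by (meson obtain_subset_with_card_n)
    have "A \<inter> W = {}" "A \<subseteq> B" "W \<subseteq> B" using S by (auto simp: A_def W_def)
    then have "leafy r B \<pi> F0"
      unfolding leafy_def using A_ne False F0 F_AW anc
      by (intro exI[of _ A] exI[of _ W]) auto
    then show ?thesis using F0 by (auto simp: F_def)
  qed
qed

section \<open>Balls and breadth-first search trees\<close>

text \<open>The vertices at distance at most \<open>k\<close> from \<open>v\<close> in the graph with edge set \<open>E\<close>.\<close>

primrec reach :: "'a set set \<Rightarrow> 'a \<Rightarrow> nat \<Rightarrow> 'a set" where
  "reach E v 0 = {v}"
| "reach E v (Suc k) = reach E v k \<union> {u. \<exists>w \<in> reach E v k. {w, u} \<in> E}"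

text \<open>The distance from \<open>v\<close>; the value is meaningful only for vertices that can be reached from \<open>v\<close>.\<close>

definition level :: "'a set set \<Rightarrow> 'a \<Rightarrow> 'a \<Rightarrow> nat" where
  "level E v u = (LEAST k. u \<in> reach E v k)"

text \<open>The breadth-first search tree of the ball of radius \<open>r\<close>: the parent of a vertex other than the
  root is its smallest neighbour on the previous level. Choosing the smallest one makes the tree insensitive
  to the deletion of other edges. Outside the tree, and at its root, the value \<open>v\<close> is a
  default, so that the function depends on the tree only.\<close>

definition parent :: "nat set set \<Rightarrow> nat \<Rightarrow> nat \<Rightarrow> nat \<Rightarrow> nat" where
  "parent E v r u = (if u \<in> reach E v r - {v}
     then LEAST w. w \<in> reach E v (level E v u - 1) \<and> {w, u} \<in> E else v)"

lemma root_in_reach [simp]: "v \<in> reach E v k"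
  by (induction k) auto

lemma reach_mono: "i \<le> j \<Longrightarrow> reach E v i \<subseteq> reach E v j"
  by (induction j) (auto simp: le_Suc_eq)

lemma reach_subset: "E \<subseteq> all_pairs V \<Longrightarrow> v \<in> V \<Longrightarrow> reach E v k \<subseteq> V"
  by (induction k) (auto simp: all_pairs_def)

lemma reach_mono_edges: "E \<subseteq> E' \<Longrightarrow> reach E v k \<subseteq> reach E' v k"
  by (induction k) auto

lemma walk_snoc:
  assumes "walk G xs" "{last xs, u} \<in> edges G" "u \<in> verts G"
  shows "walk G (xs @ [u])"
  using assms by (auto simp: walk_def successively_append_iff)

lemma reach_iff_walk:
  assumes E: "E \<subseteq> all_pairs V" and v: "v \<in> V"
  shows "u \<in> reach E v k \<longleftrightarrow> (\<exists>xs. walk (V, E) xs \<and> hd xs = v \<and> last xs = u \<and> length xs - 1 \<le> k)"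
proof
  show "u \<in> reach E v k \<Longrightarrow> \<exists>xs. walk (V, E) xs \<and> hd xs = v \<and> last xs = u \<and> length xs - 1 \<le> k"
  proof (induction k arbitrary: u)
    case 0
    then show ?case using v by (intro exI[of _ "[v]"]) (auto simp: walk_def)
  next
    case (Suc k)
    show ?case
    proof (cases "u \<in> reach E v k")
      case True
      then show ?thesis using Suc.IH le_SucI by blast
    next
      case False
      then obtain w where w: "w \<in> reach E v k" "{w, u} \<in> E" using Suc.prems by auto
      obtain xs where xs: "walk (V, E) xs" "hd xs = v" "last xs = w" "length xs - 1 \<le> k"
        using Suc.IH[OF w(1)] by blast
      have "u \<in> V" using w E by (auto simp: all_pairs_def)
      then have "walk (V, E) (xs @ [u])" using walk_snoc[OF xs(1)] w xs by simp
      then show ?thesis using xs by (intro exI[of _ "xs @ [u]"]) (auto simp: walk_def)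
    qed
  qed
next
  have "walk (V, E) xs \<Longrightarrow> hd xs = v \<Longrightarrow> length xs - 1 \<le> k \<Longrightarrow> last xs \<in> reach E v k" for xs
  proof (induction xs arbitrary: k rule: rev_induct)
    case Nil
    then show ?case by (simp add: walk_def)
  next
    case (snoc u xs)
    show ?case
    proof (cases "xs = []")
      case True
      then show ?thesis using snoc.prems by simp
    next
      case False
      then obtain j where j: "k = Suc j" using snoc.prems(3) by (cases k) auto
      have "walk (V, E) xs" "{last xs, u} \<in> E"
        using snoc.prems(1) False by (auto simp: walk_def successively_append_iff)
      moreover have "hd xs = v" using snoc.prems(2) False by simp
      ultimately have "last xs \<in> reach E v j" using snoc.IH[of j] snoc.prems(3) j by simp
      then show ?thesis using j \<open>{last xs, u} \<in> E\<close> by auto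
    qed
  qed
  then show "\<exists>xs. walk (V, E) xs \<and> hd xs = v \<and> last xs = u \<and> length xs - 1 \<le> k \<Longrightarrow> u \<in> reach E v k"
    by blast
qed

lemma graph_dist_le_iff:
  assumes E: "E \<subseteq> all_pairs V" and v: "v \<in> V"
  shows "graph_dist (V, E) v u \<le> enat k \<longleftrightarrow> u \<in> reach E v k"
proof -
  let ?L = "(\<lambda>xs. enat (length xs - 1)) ` {xs. walk (V, E) xs \<and> hd xs = v \<and> last xs = u}"
  have "Inf ?L \<le> enat k \<longleftrightarrow> (\<exists>x \<in> ?L. x \<le> enat k)"
  proof
    assume "Inf ?L \<le> enat k"
    moreover have "?L \<noteq> {}"
    proof
      assume "?L = {}"
      then have "Inf ?L = \<infinity>" by (simp only: Inf_empty top_enat_def)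
      then show False using \<open>Inf ?L \<le> enat k\<close> by simp
    qed
    ultimately show "\<exists>x \<in> ?L. x \<le> enat k" using wellorder_InfI[of _ ?L] by blast
  qed (blast intro: Inf_lower2)
  then show ?thesis unfolding graph_dist_def reach_iff_walk[OF E v] by auto
qed

lemma graph_ball_eq:
  assumes "E \<subseteq> all_pairs V" "v \<in> V"
  shows "graph_ball r v (V, E) = (reach E v r, {e \<in> E. e \<subseteq> reach E v r})"
proof -
  have "{w \<in> V. graph_dist (V, E) v w \<le> enat r} = reach E v r"
    using graph_dist_le_iff[OF assms] reach_subset[OF assms] by auto
  then show ?thesis
    using reach_subset[OF assms, of r] by (simp add: graph_ball_def induced_subgraph_def Int_absorb1)
qed

lemma in_reach_level: "u \<in> reach E v k \<Longrightarrow> u \<in> reach E v (level E v u)"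
  unfolding level_def by (rule LeastI)

lemma level_le: "u \<in> reach E v k \<Longrightarrow> level E v u \<le> k"
  unfolding level_def by (rule Least_le)

lemma level_eq_0: "u \<in> reach E v k \<Longrightarrow> level E v u = 0 \<longleftrightarrow> u = v"
  using in_reach_level[of u E v k] level_le[of v E v 0] by auto

lemma parent_props:
  assumes "u \<in> reach E v r" "u \<noteq> v"
  shows "parent E v r u \<in> reach E v (level E v u - 1)" "{parent E v r u, u} \<in> E"
    "level E v u = Suc (level E v (parent E v r u))"
proof -
  let ?P = "\<lambda>w. w \<in> reach E v (level E v u - 1) \<and> {w, u} \<in> E"
  obtain l where l: "level E v u = Suc l" using level_eq_0[OF assms(1)] assms(2) by (cases "level E v u") auto
  have "u \<in> reach E v (Suc l)" using in_reach_level[OF assms(1)] l by simp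
  moreover have "u \<notin> reach E v l" using level_le[of u E v l] l by auto
  ultimately have "\<exists>w. ?P w" using l by auto
  then have "?P (LEAST w. ?P w)" by (rule LeastI_ex)
  then have "?P (parent E v r u)" using assms by (simp add: parent_def)
  then show 1: "parent E v r u \<in> reach E v (level E v u - 1)" "{parent E v r u, u} \<in> E" by auto
  have "level E v (parent E v r u) \<le> l" using level_le[OF 1(1)] l by simp
  moreover have "u \<in> reach E v (Suc (level E v (parent E v r u)))"
    using in_reach_level[OF 1(1)] 1(2) by auto
  then have "Suc l \<le> Suc (level E v (parent E v r u))" using level_le l by metis
  ultimately show "level E v u = Suc (level E v (parent E v r u))" using l by simp
qed

lemma parent_in_ball:
  assumes "u \<in> reach E v r" "u \<noteq> v"
  shows "parent E v r u \<in> reach E v r"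
  using parent_props(1)[OF assms] reach_mono[of "level E v u - 1" r E v] level_le[OF assms(1)]
  by (meson diff_le_self le_trans subsetD)

lemma edge_at_root_in_tree:
  assumes "e \<in> E" "v \<in> e" "e \<in> all_pairs (reach E v r)"
  shows "e \<in> tree_edges (reach E v r) v (parent E v r)"
proof -
  obtain x where x: "e = {x, v}" "x \<noteq> v" "x \<in> reach E v r"
    using assms(2,3) by (auto elim!: all_pairsE)
  have "x \<in> reach E v 1" using assms(1) x by (auto simp: insert_commute)
  then have "level E v x \<le> 1" by (rule level_le)
  then have "parent E v r x \<in> reach E v 0" using parent_props(1)[OF x(3,2)] by auto
  then have "parent E v r x = v" by simp
  then show ?thesis using x by (auto simp: tree_edges_def)
qed

text \<open>Deleting edges outside the tree cannot shorten distances, and it cannot lengthen those from the root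
  within the ball either, because the tree survives.\<close>

lemma delete_non_tree_edges:
  assumes avoid: "F \<inter> tree_edges (reach E v r) v (parent E v r) = {}"
  shows "reach (E - F) v r = reach E v r" "parent (E - F) v r = parent E v r"
proof -
  have kept: "{parent E v r u, u} \<in> E - F" if "u \<in> reach E v r" "u \<noteq> v" for u
  proof -
    have "{u, parent E v r u} \<in> tree_edges (reach E v r) v (parent E v r)"
      using that unfolding tree_edges_def by blast
    then have "{parent E v r u, u} \<notin> F" using avoid insert_commute[of u "parent E v r u" "{}"] by (metis disjoint_iff)
    then show ?thesis using parent_props(2)[OF that] by blast
  qed
  have reach: "reach (E - F) v k = reach E v k" if "k \<le> r" for k
    using that
  proof (induction k)
    case (Suc k)
    have "u \<in> reach (E - F) v (Suc k)" if u: "u \<in> reach E v (Suc k)" for u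
    proof (cases "u \<in> reach E v k")
      case True
      then show ?thesis using Suc by auto
    next
      case False
      have ur: "u \<in> reach E v r" using subsetD[OF reach_mono[OF Suc.prems] u] .
      have "u \<noteq> v" using False by auto
      have "level E v u \<le> Suc k" using u by (rule level_le)
      then have "level E v u - 1 \<le> k" by simp
      then have "parent E v r u \<in> reach E v k"
        using subsetD[OF reach_mono parent_props(1)[OF ur \<open>u \<noteq> v\<close>]] by blast
      then show ?thesis using Suc kept[OF ur \<open>u \<noteq> v\<close>] by auto
    qed
    then show ?case using reach_mono_edges[of "E - F" E v "Suc k"] by blast
  qed simp
  show ball: "reach (E - F) v r = reach E v r" using reach by simp
  have level: "level (E - F) v u = level E v u" if u: "u \<in> reach E v r" for u
  proof -
    have "u \<in> reach (E - F) v (level E v u)"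
      using reach[of "level E v u"] level_le[OF u] in_reach_level[OF u] by simp
    then have "level (E - F) v u \<le> level E v u" by (rule level_le)
    moreover have "u \<in> reach E v (level (E - F) v u)"
      using in_reach_level[of u "E - F" v r] ball u reach_mono_edges[of "E - F" E v] by blast
    then have "level E v u \<le> level (E - F) v u" by (rule level_le)
    ultimately show ?thesis by simp
  qed
  show "parent (E - F) v r = parent E v r"
  proof
    fix u
    show "parent (E - F) v r u = parent E v r u"
    proof (cases "u \<in> reach E v r - {v}")
      case True
      define l where "l = level E v u - 1"
      have l: "reach (E - F) v l = reach E v l" using reach[of l] level_le[of u E v r] True by (auto simp: l_def)
      have p: "parent E v r u = (LEAST w. w \<in> reach E v l \<and> {w, u} \<in> E)"
        using True by (simp add: parent_def l_def)
      have "(LEAST w. w \<in> reach E v l \<and> {w, u} \<in> E - F) = parent E v r u"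
      proof (rule Least_equality)
        show "parent E v r u \<in> reach E v l \<and> {parent E v r u, u} \<in> E - F"
          using kept[of u] parent_props(1)[of u E v r] True by (auto simp: l_def)
        show "parent E v r u \<le> w" if "w \<in> reach E v l \<and> {w, u} \<in> E - F" for w
          unfolding p using that by (intro Least_le) auto
      qed
      then show ?thesis using True ball l level[of u] by (simp add: parent_def l_def)
    qed (simp only: parent_def ball if_False)
  qed
qed

lemma card_reach_le:
  assumes fin: "finite E" and E: "E \<subseteq> all_pairs V" and deg: "\<And>x. real (card {e \<in> E. x \<in> e}) \<le> \<Delta>"
  shows "finite (reach E v k) \<and> real (card (reach E v k)) \<le> (\<Sum>i\<le>k. \<Delta> ^ i)"
proof (induction k)
  case (Suc k)
  have nb: "finite {u. {w, u} \<in> E} \<and> real (card {u. {w, u} \<in> E}) \<le> \<Delta>" for w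
  proof -
    have inj: "inj_on (\<lambda>u. {w, u}) {u. {w, u} \<in> E}" by (auto simp: inj_on_def doubleton_eq_iff)
    have sub: "(\<lambda>u. {w, u}) ` {u. {w, u} \<in> E} \<subseteq> {e \<in> E. w \<in> e}" by auto
    have "finite {u. {w, u} \<in> E}" using finite_imageD[OF finite_subset[OF sub] inj] fin by simp
    moreover have "card {u. {w, u} \<in> E} \<le> card {e \<in> E. w \<in> e}"
      using card_inj_on_le[OF inj sub] fin by simp
    ultimately show ?thesis using deg[of w] by linarith
  qed
  have "reach E v (Suc k) \<subseteq> insert v (\<Union>w\<in>reach E v k. {u. {w, u} \<in> E})" (is "_ \<subseteq> ?U")
    by (induction k) auto
  moreover have finU: "finite ?U" using Suc nb by auto
  ultimately have fin': "finite (reach E v (Suc k))" and le: "card (reach E v (Suc k)) \<le> card ?U"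
    using finite_subset card_mono by blast+
  note le
  also have "card ?U \<le> Suc (card (\<Union>w\<in>reach E v k. {u. {w, u} \<in> E}))"
    using finU by (simp add: card_insert_if)
  also have "\<dots> \<le> Suc (\<Sum>w\<in>reach E v k. card {u. {w, u} \<in> E})"
    using Suc by (intro Suc_le_mono[THEN iffD2] card_UN_le) auto
  finally have "real (card (reach E v (Suc k))) \<le> real (Suc (\<Sum>w\<in>reach E v k. card {u. {w, u} \<in> E}))"
    using of_nat_mono by blast
  also have "\<dots> = 1 + (\<Sum>w\<in>reach E v k. real (card {u. {w, u} \<in> E}))" by simp
  also have "\<dots> \<le> 1 + (\<Sum>w\<in>reach E v k. \<Delta>)" using nb by (intro add_left_mono sum_mono) auto
  also have "\<dots> = 1 + real (card (reach E v k)) * \<Delta>" by simp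
  also have "\<dots> \<le> 1 + (\<Sum>i\<le>k. \<Delta> ^ i) * \<Delta>"
  proof -
    have "0 \<le> \<Delta>" using deg[of v] of_nat_0_le_iff order_trans by blast
    then show ?thesis using Suc by (intro add_left_mono mult_right_mono) auto
  qed
  also have "\<dots> = (\<Sum>i\<le>Suc k. \<Delta> ^ i)"
    by (subst sum.atMost_Suc_shift) (simp add: sum_distrib_left mult.commute)
  finally show ?case using fin' by simp
qed simp

lemma not_degenerate_structure:
  assumes fin: "finite V" and E: "E \<subseteq> all_pairs V" and v: "v \<in> V"
    and nd: "\<not> degenerate 2 (graph_ball r v (V, E))"
  defines "B \<equiv> reach E v r"
  shows "\<exists>F \<subseteq> E - tree_edges B v (parent E v r). cyclic B F \<or> leafy r B (parent E v r) F"
proof -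
  obtain H where H: "subgraph H (B, {e \<in> E. e \<subseteq> B})" "verts H \<noteq> {}" "2 < min_degree H"
    using nd unfolding degenerate_def graph_ball_eq[OF E v] B_def by (meson not_le)
  have finB: "finite B" using reach_subset[OF E v] fin finite_subset unfolding B_def by blast
  have S: "verts H \<subseteq> B" "edges H \<subseteq> all_pairs (verts H)" "edges H \<subseteq> E" "finite (verts H)"
    using H(1) by (auto simp: subgraph_def simple_graph_def)
  have deg: "3 \<le> card {e \<in> edges H. x \<in> e}" if "x \<in> verts H" for x
  proof -
    have "min_degree H \<le> vdegree H x" unfolding min_degree_def using that S by (intro Min_le) auto
    then show ?thesis using H(3) by (simp add: vdegree_def)
  qed
  have "\<exists>F \<subseteq> edges H - tree_edges B v (parent E v r). cyclic B F \<or> leafy r B (parent E v r) F"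
    (is "\<exists>F \<subseteq> _. ?Q F")
  proof (rule dense_structure[where lev = "level E v"])
    show "level E v x = 0 \<longleftrightarrow> x = v" if "x \<in> B" for x using level_eq_0 that unfolding B_def .
    show "level E v x = Suc (level E v (parent E v r x))" if "x \<in> B" "x \<noteq> v" for x
      using parent_props(3) that unfolding B_def by blast
    show "level E v x \<le> r" if "x \<in> B" for x using level_le that unfolding B_def .
    show "e \<in> tree_edges B v (parent E v r)" if "e \<in> edges H" "v \<in> e" for e
      unfolding B_def
    proof (rule edge_at_root_in_tree)
      show "e \<in> all_pairs (reach E v r)" using that S by (auto simp: all_pairs_def B_def)
    qed (use that S in auto)
  qed (use finB H(2) S deg in auto)
  then obtain F where "F \<subseteq> edges H - tree_edges B v (parent E v r)" "?Q F" by blast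
  moreover have "edges H - tree_edges B v (parent E v r) \<subseteq> E - tree_edges B v (parent E v r)"
    using S(3) by (rule Diff_mono) simp
  ultimately show ?thesis by (meson order_trans)
qed

section \<open>Random edge sets\<close>

text \<open>The probability that the random subset of \<open>X\<close>, which contains each element independently with
  probability \<open>p\<close>, equals \<open>E\<close>.\<close>

definition weight :: "'a set \<Rightarrow> real \<Rightarrow> 'a set \<Rightarrow> real" where
  "weight X p E = p ^ card E * (1 - p) ^ card (X - E)"

lemma weight_nonneg: "0 \<le> p \<Longrightarrow> p \<le> 1 \<Longrightarrow> 0 \<le> weight X p E"
  by (simp add: weight_def)

lemma sum_weight: "finite X \<Longrightarrow> (\<Sum>E\<in>Pow X. weight X p E) = 1"
  using prod_add[of X "\<lambda>_. p" "\<lambda>_. 1 - p"] by (simp add: weight_def)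

lemma prob_erdos_renyi:
  fixes n :: nat and p :: real
  assumes p: "0 \<le> p" "p \<le> 1"
  defines "X \<equiv> all_pairs {..<n}"
  shows "measure_pmf.prob (erdos_renyi n p) {G. Q G} = sum (weight X p) {E \<in> Pow X. Q ({..<n}, E)}"
proof -
  have fin: "finite X" by (simp add: X_def)
  let ?P = "Pi_pmf X False (\<lambda>_. bernoulli_pmf p)"
  let ?h = "\<lambda>f. ({..<n}, {e \<in> X. f e})"
  let ?I = "\<lambda>E e. e \<in> E"
  let ?S = "{E \<in> Pow X. Q ({..<n}, E)}"
  have "measure_pmf.prob (erdos_renyi n p) {G. Q G} = measure_pmf.prob ?P {f. Q (?h f)}"
    by (simp add: erdos_renyi_def X_def vimage_def)
  also have "\<dots> = measure_pmf.prob ?P (?I ` ?S)"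
  proof (rule measure_prob_cong_0)
    fix f assume f: "f \<in> {f. Q (?h f)} - ?I ` ?S"
    have "\<exists>e. e \<notin> X \<and> f e"
    proof (rule ccontr)
      assume "\<not> ?thesis"
      then have "f = ?I {e \<in> X. f e}" by auto
      moreover have "{e \<in> X. f e} \<in> ?S" using f by auto
      ultimately show False using f by blast
    qed
    then show "pmf ?P f = 0" using pmf_Pi_outside[OF fin, of f False] by auto
  next
    fix f assume f: "f \<in> ?I ` ?S - {f. Q (?h f)}"
    then obtain E where E: "f = ?I E" "E \<subseteq> X" "Q ({..<n}, E)" by auto
    then have "{e \<in> X. f e} = E" by auto
    then show "pmf ?P f = 0" using f E by auto
  qed
  also have "\<dots> = sum (pmf ?P) (?I ` ?S)"
    using fin by (intro measure_measure_pmf_finite) auto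
  also have "\<dots> = (\<Sum>E\<in>?S. pmf ?P (?I E))"
    by (subst sum.reindex) (auto simp: inj_on_def fun_eq_iff)
  also have "\<dots> = sum (weight X p) ?S"
  proof (rule sum.cong)
    fix E assume "E \<in> ?S"
    then have E: "E \<subseteq> X" by auto
    have "pmf ?P (?I E) = (\<Prod>e\<in>X. if e \<in> E then p else 1 - p)"
      using E p by (subst pmf_Pi'[OF fin]) (auto intro!: prod.cong)
    also have "\<dots> = weight X p E"
      using fin E by (simp add: prod.If_cases weight_def Int_absorb1 Diff_eq)
    finally show "pmf ?P (?I E) = weight X p E" .
  qed simp
  finally show ?thesis .
qed

text \<open>A union bound in which the family \<open>\<F> E\<close> of forbidden sets may depend on the random set \<open>E\<close>
  itself, as long as deleting a forbidden set does not change the family. It holds because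
  \<open>(E, F) \<mapsto> (E - F, F)\<close> is injective on pairs with \<open>F \<subseteq> E\<close> and divides the weight of the first
  component by \<open>(p / (1 - p)) ^ card F\<close>. This replaces conditioning on the breadth-first search tree.\<close>

lemma sum_weight_deletion:
  assumes fin: "finite X" and p: "0 < p" "p < 1"
    and bad: "\<And>E. E \<in> bad \<Longrightarrow> E \<subseteq> X \<and> (\<exists>F \<subseteq> E. F \<in> \<F> E)"
    and invariant: "\<And>E F. E \<subseteq> X \<Longrightarrow> F \<subseteq> E \<Longrightarrow> F \<in> \<F> E \<Longrightarrow> \<F> (E - F) = \<F> E"
    and fin_\<F>: "\<And>E. E \<subseteq> X \<Longrightarrow> finite (\<F> E)"
    and bound: "\<And>E. E \<subseteq> X \<Longrightarrow> (\<Sum>F\<in>\<F> E. (p / (1 - p)) ^ card F) \<le> s"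
  shows "sum (weight X p) bad \<le> s"
proof -
  define q where "q = p / (1 - p)"
  have q: "0 \<le> q" using p by (simp add: q_def)
  have w0: "0 \<le> weight X p E" for E using p by (simp add: weight_nonneg)
  define I where "I = (SIGMA E:Pow X. {F \<in> \<F> E. F \<subseteq> E})"
  define J where "J = (SIGMA E:Pow X. \<F> E)"
  have finI: "finite I" unfolding I_def using fin fin_\<F> by (intro finite_SigmaI) auto
  have finJ: "finite J" unfolding J_def using fin fin_\<F> by (intro finite_SigmaI) auto
  have "bad \<subseteq> fst ` I"
  proof
    fix E assume "E \<in> bad"
    then obtain F where "E \<subseteq> X" "F \<subseteq> E" "F \<in> \<F> E" using bad by meson
    then have "(E, F) \<in> I" by (simp add: I_def)
    then show "E \<in> fst ` I" by (rule rev_image_eqI) simp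
  qed
  then have "sum (weight X p) bad \<le> sum (weight X p) (fst ` I)"
    using w0 finI by (intro sum_mono2) auto
  also have "\<dots> \<le> (\<Sum>x\<in>I. weight X p (fst x))"
    using sum_image_le[OF finI, of "weight X p" fst] w0 by (simp add: o_def)
  also have "\<dots> = (\<Sum>(E, F)\<in>I. weight X p (E - F) * q ^ card F)"
  proof (rule sum.cong[OF refl])
    fix x assume "x \<in> I"
    then obtain E F where x: "x = (E, F)" "(E, F) \<in> I" by (cases x) auto
    have EF: "E \<subseteq> X" "F \<subseteq> E" using x(2) unfolding I_def by blast+
    have fE: "finite E" "finite F"
      using finite_subset[OF EF(1) fin] finite_subset[OF EF(2)] by auto
    have "card E = card (E - F) + card F"
      using card_Diff_subset[OF fE(2) EF(2)] card_mono[OF fE(1) EF(2)] by simp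
    moreover have "card (X - (E - F)) = card (X - E) + card F"
    proof -
      have "X - (E - F) = (X - E) \<union> F" using EF by auto
      moreover have "card ((X - E) \<union> F) = card (X - E) + card F"
        using fin fE EF by (intro card_Un_disjoint) auto
      ultimately show ?thesis by simp
    qed
    ultimately show "weight X p (fst x) = (case x of (E, F) \<Rightarrow> weight X p (E - F) * q ^ card F)"
      using p x(1) by (simp add: weight_def q_def power_add power_divide)
  qed
  also have "\<dots> = (\<Sum>(E, F)\<in>(\<lambda>(E, F). (E - F, F)) ` I. weight X p E * q ^ card F)"
  proof (subst sum.reindex)
    show "inj_on (\<lambda>(E, F). (E - F, F)) I" by (auto simp: inj_on_def I_def)
    show "(\<Sum>(E, F)\<in>I. weight X p (E - F) * q ^ card F)
      = sum ((\<lambda>(E, F). weight X p E * q ^ card F) \<circ> (\<lambda>(E, F). (E - F, F))) I"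
      by (simp add: o_def case_prod_unfold)
  qed
  also have "\<dots> \<le> (\<Sum>(E, F)\<in>J. weight X p E * q ^ card F)"
  proof (rule sum_mono2[OF finJ])
    show "(\<lambda>(E, F). (E - F, F)) ` I \<subseteq> J" using invariant by (auto simp: I_def J_def)
  qed (use w0 q in auto)
  also have "\<dots> = (\<Sum>E\<in>Pow X. weight X p E * (\<Sum>F\<in>\<F> E. q ^ card F))"
    unfolding J_def using fin fin_\<F> by (subst sum.Sigma[symmetric]) (auto simp: sum_distrib_left)
  also have "\<dots> \<le> (\<Sum>E\<in>Pow X. weight X p E * s)"
    using bound w0 by (intro sum_mono mult_left_mono) (auto simp: q_def)
  also have "\<dots> = s" using sum_weight[OF fin] by (simp add: sum_distrib_right[symmetric])
  finally show ?thesis .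
qed

text \<open>The Chernoff bound for the degree of \<open>x\<close>, from the moment generating function at
  \<open>ln (1 + \<delta>)\<close>.\<close>

lemma sum_weight_degree_tail:
  fixes n :: nat and p \<delta> \<mu> :: real
  assumes p: "0 \<le> p" "p \<le> 1" and \<delta>: "0 < \<delta>" and \<mu>: "real n * p \<le> \<mu>" and x: "x < n"
  defines "X \<equiv> all_pairs {..<n}"
  shows "sum (weight X p) {E \<in> Pow X. (1 + \<delta>) * \<mu> < real (card {e \<in> E. x \<in> e})}
    \<le> exp (- \<mu> * ((1 + \<delta>) * ln (1 + \<delta>) - \<delta>))"
proof -
  have fin: "finite X" by (simp add: X_def)
  let ?d = "\<lambda>E. card {e \<in> E. x \<in> e}"
  let ?S = "{E \<in> Pow X. (1 + \<delta>) * \<mu> < real (?d E)}"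
  define c where "c = exp (- ((1 + \<delta>) * \<mu> * ln (1 + \<delta>)))"
  have w0: "0 \<le> weight X p E" for E using p by (simp add: weight_nonneg)
  have "sum (weight X p) ?S \<le> (\<Sum>E\<in>?S. weight X p E * ((1 + \<delta>) ^ ?d E * c))"
  proof (rule sum_mono)
    fix E assume "E \<in> ?S"
    then have "(1 + \<delta>) * \<mu> * ln (1 + \<delta>) \<le> real (?d E) * ln (1 + \<delta>)"
      using \<delta> by (intro mult_right_mono) auto
    then have "1 \<le> exp (real (?d E) * ln (1 + \<delta>) - (1 + \<delta>) * \<mu> * ln (1 + \<delta>))" by simp
    also have "\<dots> = (1 + \<delta>) ^ ?d E * c"
      using \<delta> by (simp add: c_def diff_conv_add_uminus exp_add exp_of_nat_mult del: add_uminus_conv_diff)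
    finally show "weight X p E \<le> weight X p E * ((1 + \<delta>) ^ ?d E * c)"
      using mult_left_mono[OF _ w0[of E]] by fastforce
  qed
  also have "\<dots> \<le> (\<Sum>E\<in>Pow X. weight X p E * ((1 + \<delta>) ^ ?d E * c))"
    using fin w0 \<delta> by (intro sum_mono2) (auto simp: c_def)
  also have "\<dots> = c * (\<Sum>E\<in>Pow X. weight X p E * (1 + \<delta>) ^ ?d E)"
    by (simp add: sum_distrib_left algebra_simps)
  also have "(\<Sum>E\<in>Pow X. weight X p E * (1 + \<delta>) ^ ?d E)
      = (\<Sum>E\<in>Pow X. (\<Prod>e\<in>E. p * (if x \<in> e then 1 + \<delta> else 1)) * (\<Prod>e\<in>X - E. 1 - p))"
  proof (rule sum.cong)
    fix E assume "E \<in> Pow X"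
    then have "finite E" using fin finite_subset by auto
    then show "weight X p E * (1 + \<delta>) ^ ?d E
      = (\<Prod>e\<in>E. p * (if x \<in> e then 1 + \<delta> else 1)) * (\<Prod>e\<in>X - E. 1 - p)"
      by (simp add: weight_def prod.distrib prod.If_cases Int_def)
  qed simp
  also have "\<dots> = (\<Prod>e\<in>X. p * (if x \<in> e then 1 + \<delta> else 1) + (1 - p))"
    using fin by (rule prod_add[symmetric])
  also have "\<dots> = (1 + \<delta> * p) ^ card {e \<in> X. x \<in> e}"
  proof -
    have "(\<Prod>e\<in>X. p * (if x \<in> e then 1 + \<delta> else 1) + (1 - p)) = (\<Prod>e\<in>X. if x \<in> e then 1 + \<delta> * p else 1)"
      by (intro prod.cong) (auto simp: algebra_simps)
    then show ?thesis using fin by (simp add: prod.If_cases Int_def)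
  qed
  also have "\<dots> \<le> (1 + \<delta> * p) ^ n"
  proof (rule power_increasing)
    have "{e \<in> X. x \<in> e} \<subseteq> (\<lambda>y. {x, y}) ` {..<n}"
      by (auto simp: X_def elim!: all_pairsE)
    then have "card {e \<in> X. x \<in> e} \<le> card ((\<lambda>y. {x, y}) ` {..<n})" by (intro card_mono) auto
    then show "card {e \<in> X. x \<in> e} \<le> n" using card_image_le[of "{..<n}" "\<lambda>y. {x, y}"] by simp
  qed (use \<delta> p in simp)
  also have "\<dots> \<le> exp (\<delta> * p) ^ n"
    using exp_ge_add_one_self[of "\<delta> * p"] \<delta> p by (intro power_mono) auto
  also have "\<dots> = exp (\<delta> * (real n * p))" by (simp add: exp_of_nat_mult[symmetric] algebra_simps)
  also have "\<dots> \<le> exp (\<delta> * \<mu>)" using \<mu> \<delta> by simp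
  finally have "sum (weight X p) ?S \<le> c * exp (\<delta> * \<mu>)" by (simp add: c_def)
  also have "\<dots> = exp (- \<mu> * ((1 + \<delta>) * ln (1 + \<delta>) - \<delta>))"
    by (simp add: c_def exp_add[symmetric] algebra_simps)
  finally show ?thesis .
qed

section \<open>First moment bounds\<close>

lemma power_le_exp_fact:
  fixes x :: real
  assumes "0 \<le> x"
  shows "x ^ k \<le> exp x * fact k"
proof -
  have "(\<Sum>n\<in>{k}. x ^ n /\<^sub>R fact n) \<le> (\<Sum>n. x ^ n /\<^sub>R fact n)"
    using assms by (intro sum_le_suminf summable_exp_generic) auto
  then show ?thesis by (simp add: exp_def field_simps)
qed

lemma fact_add_le: "fact (a + h) \<le> (fact a * real (a + h) ^ h :: real)"
proof (induction h)
  case (Suc h)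
  have "fact (a + Suc h) = real (a + Suc h) * fact (a + h)" by simp
  also have "\<dots> \<le> real (a + Suc h) * (fact a * real (a + h) ^ h)"
    using Suc by (intro mult_left_mono) auto
  also have "\<dots> \<le> real (a + Suc h) * (fact a * real (a + Suc h) ^ h)"
    by (intro mult_left_mono power_mono) auto
  finally show ?case by (simp add: mult_ac)
qed simp

lemma sum_geometric_le:
  fixes x :: real
  assumes "0 \<le> x" "x < 1"
  shows "(\<Sum>k=m..n. x ^ k) \<le> x ^ m / (1 - x)"
  using assms by (auto simp: sum_gp divide_right_mono)

lemma sum_UNION_le:
  fixes f :: "'b \<Rightarrow> real"
  assumes "finite I" "\<And>i. i \<in> I \<Longrightarrow> finite (A i)" "\<And>x. 0 \<le> f x"
  shows "sum f (\<Union>i\<in>I. A i) \<le> (\<Sum>i\<in>I. sum f (A i))"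
proof -
  have "(\<Union>i\<in>I. A i) = snd ` Sigma I A" by force
  then have "sum f (\<Union>i\<in>I. A i) \<le> sum (f \<circ> snd) (Sigma I A)"
    using assms by (simp only:) (intro sum_image_le, auto)
  also have "\<dots> = (\<Sum>i\<in>I. sum f (A i))"
    using assms by (subst sum.Sigma) (auto simp: case_prod_unfold)
  finally show ?thesis .
qed

lemma card_all_pairs: "finite S \<Longrightarrow> card (all_pairs S) = card S choose 2"
  using n_subsets[of S 2] by (simp add: all_pairs_def)

lemma sum_cyclic_le:
  fixes q M :: real
  assumes B: "finite B" "real (card B) \<le> M" and q: "0 \<le> q" and c: "M * q < 1"
  shows "finite {F. cyclic B F}"
    and "(\<Sum>F | cyclic B F. q ^ card F) \<le> (M * q) ^ 3 / (1 - M * q)"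
proof -
  let ?L = "{xs. distinct xs \<and> 3 \<le> length xs \<and> set xs \<subseteq> B}"
  let ?K = "\<lambda>k. {xs. set xs \<subseteq> B \<and> length xs = k}"
  have eq: "{F. cyclic B F} = cycle_edges ` ?L" by (auto simp: cyclic_def)
  have "?L \<subseteq> {xs. set xs \<subseteq> B \<and> distinct xs}" by auto
  then have finL: "finite ?L" by (rule finite_subset) (rule finite_subset_distinct[OF B(1)])
  then show "finite {F. cyclic B F}" unfolding eq by simp
  have "(\<Sum>F | cyclic B F. q ^ card F) \<le> (\<Sum>xs\<in>?L. q ^ card (cycle_edges xs))"
    unfolding eq using sum_image_le[OF finL, of "\<lambda>F. q ^ card F" cycle_edges] q by (simp add: o_def)
  also have "\<dots> = (\<Sum>xs\<in>?L. q ^ length xs)"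
    by (intro sum.cong) (auto simp: card_cycle_edges)
  also have "\<dots> \<le> (\<Sum>xs\<in>(\<Union>k\<in>{3..card B}. ?K k). q ^ length xs)"
  proof (rule sum_mono2)
    show "finite (\<Union>k\<in>{3..card B}. ?K k)" using B(1) by (auto intro: finite_lists_length_eq)
    show "?L \<subseteq> (\<Union>k\<in>{3..card B}. ?K k)"
    proof
      fix xs assume "xs \<in> ?L"
      then have "distinct xs" "3 \<le> length xs" "set xs \<subseteq> B" by auto
      moreover from this have "length xs \<le> card B" using B(1) by (metis card_mono distinct_card)
      ultimately show "xs \<in> (\<Union>k\<in>{3..card B}. ?K k)" by auto
    qed
  qed (use q in auto)
  also have "\<dots> = (\<Sum>k=3..card B. \<Sum>xs\<in>?K k. q ^ length xs)"
    using B(1) by (intro sum.UNION_disjoint) (auto intro: finite_lists_length_eq)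
  also have "\<dots> = (\<Sum>k=3..card B. (real (card B) * q) ^ k)"
    using B(1) by (intro sum.cong) (auto simp: card_lists_length_eq power_mult_distrib)
  also have "\<dots> \<le> (\<Sum>k=3..card B. (M * q) ^ k)"
    using B q by (intro sum_mono power_mono mult_right_mono) auto
  also have "\<dots> \<le> (M * q) ^ 3 / (1 - M * q)"
    using B q c by (intro sum_geometric_le) (auto intro!: mult_nonneg_nonneg)
  finally show "(\<Sum>F | cyclic B F. q ^ card F) \<le> (M * q) ^ 3 / (1 - M * q)" .
qed

text \<open>The number of ways to place the edges of \<^const>\<open>leafy\<close> sets on given \<open>A\<close> and \<open>W\<close> of cardinalities
  \<open>a\<close> and \<open>w\<close>, weighted by \<open>q ^ e\<close>. The factor \<open>fact a / M ^ a\<close> compensates the choice of \<open>A\<close>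
  among at most \<open>M\<close> vertices, \<open>P ^ a\<close> compensates the choice of \<open>W\<close>, and the factor \<open>1 / M\<close> that
  remains is the gain: there are \<open>e - a \<ge> 1\<close> more edges than vertices to choose freely.\<close>

lemma edge_choices_le:
  fixes q M P :: real
  assumes a: "1 \<le> a" and w: "2 \<le> w" and M: "real (a + w) \<le> M" and q: "0 \<le> q" and P: "1 \<le> P"
    and small: "2 * exp 2 * (M * q) * P \<le> 9 / 10"
  defines "e \<equiv> a + (w + 1) div 2"
  shows "real (((a + w) choose 2) choose e) * q ^ e \<le> fact a / M ^ a * (18 * (19 / 20) ^ a / M) / P ^ a"
proof -
  define h where "h = (w + 1) div 2"
  have e: "e = a + h" "1 \<le> h" "a + w \<le> 2 * e" "e \<le> a + w" using w by (auto simp: e_def h_def)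
  have M0: "0 < M" using M a by linarith
  have eM: "real e \<le> M" using M e by linarith
  have "real ((a + w) choose 2) \<le> 2 * real e ^ 2"
  proof -
    have "real (((a + w) choose 2) * fact 2) \<le> real ((a + w) ^ 2)"
      by (intro of_nat_mono binomial_fact_pow)
    moreover have "real ((a + w) ^ 2) \<le> (2 * real e) ^ 2"
      using e(3) unfolding of_nat_power by (intro power_mono) linarith+
    ultimately show ?thesis by (simp add: power2_eq_square)
  qed
  moreover have "real (((a + w) choose 2) choose e) * fact e \<le> real ((a + w) choose 2) ^ e"
    using of_nat_mono[OF binomial_fact_pow[of "(a + w) choose 2" e], where 'a = real] by simp
  ultimately have "real (((a + w) choose 2) choose e) * fact e \<le> (2 * real e ^ 2) ^ e"
    by (meson order_trans of_nat_0_le_iff power_mono)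
  also have "\<dots> = 2 ^ e * (real e ^ e) ^ 2"
    by (simp add: power_mult_distrib power_mult[symmetric] mult.commute)
  also have "\<dots> \<le> 2 ^ e * (exp (real e) * fact e) ^ 2"
    by (intro mult_left_mono power_mono power_le_exp_fact) auto
  also have "\<dots> = (2 * exp 2) ^ e * fact e * fact e"
    by (simp add: power_mult_distrib power2_eq_square exp_of_nat_mult[symmetric] exp_add[symmetric] mult_ac)
  finally have "real (((a + w) choose 2) choose e) \<le> (2 * exp 2) ^ e * fact e" by simp
  also have "\<dots> \<le> (2 * exp 2) ^ e * (fact a * real e ^ h)"
    using fact_add_le[of a h] e(1) by (intro mult_left_mono) auto
  finally have "real (((a + w) choose 2) choose e) * q ^ e \<le> (2 * exp 2) ^ e * (fact a * real e ^ h) * q ^ e"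
    using q by (intro mult_right_mono) auto
  also have "\<dots> = (2 * exp 2 * (M * q)) ^ e * (fact a / M ^ a) * (real e / M) ^ h"
    using M0 by (simp add: e(1) power_mult_distrib power_divide power_add field_simps)
  also have "\<dots> \<le> (2 * exp 2 * (M * q)) ^ e * (fact a / M ^ a) * (real e / M) ^ 1"
    using e(2) eM M0 q by (intro mult_left_mono power_decreasing) (auto simp: field_simps)
  also have "\<dots> \<le> (9 / 10 / P) ^ e * (fact a / M ^ a) * (real e / M) ^ 1"
    using M0 q P small by (intro mult_right_mono power_mono) (auto simp: field_simps)
  also have "\<dots> = real e * (9 / 10) ^ e / P ^ e * (fact a / M ^ a) / M"
    by (simp add: power_divide)
  also have "\<dots> \<le> 18 * (19 / 20) ^ a / P ^ a * (fact a / M ^ a) / M"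
  proof -
    \<comment> \<open>Raising the base of the power from \<open>9 / 10\<close> to \<open>19 / 20 = 9 / 10 * (1 + 1 / 18)\<close> absorbs the factor \<open>e\<close>.\<close>
    have "real e / 18 \<le> (1 + 1 / 18) ^ e"
      using Bernoulli_inequality[of "1 / 18 :: real" e] by simp
    then have "real e * (9 / 10) ^ e \<le> 18 * (1 + 1 / 18) ^ e * (9 / 10) ^ e"
      by (intro mult_right_mono) auto
    also have "\<dots> = 18 * (19 / 20) ^ e" by (simp add: power_mult_distrib[symmetric])
    also have "\<dots> \<le> 18 * (19 / 20) ^ a" using e(1) by (intro mult_left_mono power_decreasing) auto
    finally have 1: "real e * (9 / 10) ^ e \<le> 18 * (19 / 20) ^ a" .
    have "P ^ a \<le> P ^ e" using P e(1) by (intro power_increasing) auto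
    then have "real e * (9 / 10) ^ e / P ^ e \<le> 18 * (19 / 20) ^ a / P ^ a"
      using 1 P by (intro frac_le) auto
    then show ?thesis using M0 by (intro divide_right_mono mult_right_mono) auto
  qed
  finally show ?thesis by (simp add: mult_ac)
qed

lemma card_ancestors_le: "card (ancestors r \<pi> x) \<le> r - 1"
  unfolding ancestors_def using card_image_le[of "{1..<r}" "\<lambda>i. (\<pi> ^^ i) x"] by simp

lemma finite_ancestors [simp]: "finite (ancestors r \<pi> x)"
  by (simp add: ancestors_def)

lemma leafy_height: "leafy r B \<pi> F \<Longrightarrow> 2 \<le> r"
proof (rule ccontr)
  assume "leafy r B \<pi> F" "\<not> 2 \<le> r"
  moreover from this have "ancestors r \<pi> a = {}" for a by (auto simp: ancestors_def)
  ultimately show False by (auto simp: leafy_def)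
qed

lemma sum_leafy_le:
  fixes q M :: real
  assumes B: "finite B" "real (card B) \<le> M" and q: "0 \<le> q" and M: "0 < M"
    and small: "2 * exp 2 * (M * q) * 2 ^ (r - 1) \<le> 9 / 10"
  shows "finite {F. leafy r B \<pi> F}"
    and "(\<Sum>F | leafy r B \<pi> F. q ^ card F) \<le> 360 / M"
proof -
  define anc where "anc A = (\<Union>a\<in>A. ancestors r \<pi> a)" for A
  define I where "I = Pow B - {{}}"
  define J where "J A = {W. W \<subseteq> anc A \<and> W \<subseteq> B \<and> A \<inter> W = {} \<and> 2 \<le> card W}" for A
  define K where "K A W = {F. F \<subseteq> all_pairs (A \<union> W) \<and> card F = card A + (card W + 1) div 2}" for A W :: "'a set"
  define g where "g a = fact a / M ^ a * (18 * (19 / 20) ^ a / M)" for a :: nat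
  define P :: real where "P = 2 ^ (r - 1)"
  have g0: "0 \<le> g a" for a using M by (simp add: g_def)
  have finA: "finite A" if "A \<in> I" for A using that B(1) finite_subset by (auto simp: I_def)
  have finJ: "finite (J A)" if "A \<in> I" for A
    using B(1) by (intro finite_subset[of "J A" "Pow B"]) (auto simp: J_def)
  have finW: "finite W" if "W \<in> J A" for A W
    using that B(1) finite_subset by (auto simp: J_def)
  have finK: "finite (K A W)" if "A \<in> I" "W \<in> J A" for A W
    using finA[OF that(1)] finW[OF that(2)]
    by (intro finite_subset[of "K A W" "Pow (all_pairs (A \<union> W))"]) (auto simp: K_def)
  have sub: "{F. leafy r B \<pi> F} \<subseteq> (\<Union>A\<in>I. \<Union>W\<in>J A. K A W)"
    unfolding leafy_def I_def J_def K_def anc_def by blast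
  have finI: "finite I" using B(1) by (simp add: I_def)
  have fin: "finite (\<Union>A\<in>I. \<Union>W\<in>J A. K A W)" using finI finJ finK by blast
  show "finite {F. leafy r B \<pi> F}" using finite_subset[OF sub fin] .
  have inner: "(\<Sum>F\<in>K A W. q ^ card F) \<le> g (card A) / P ^ card A" if A: "A \<in> I" and W: "W \<in> J A" for A W
  proof -
    define e where "e = card A + (card W + 1) div 2"
    have AW: "A \<inter> W = {}" "A \<union> W \<subseteq> B" "A \<noteq> {}" "2 \<le> card W" using A W by (auto simp: I_def J_def)
    have cAW: "card (A \<union> W) = card A + card W"
      using finA[OF A] finW[OF W] AW by (intro card_Un_disjoint) auto
    have "(\<Sum>F\<in>K A W. q ^ card F) = real (card (K A W)) * q ^ e"
      by (simp add: K_def e_def)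
    also have "card (K A W) = ((card A + card W) choose 2) choose e"
      unfolding K_def e_def[symmetric] using finA[OF A] finW[OF W] cAW
      by (simp add: n_subsets card_all_pairs)
    also have "real \<dots> * q ^ e \<le> g (card A) / P ^ card A"
      unfolding g_def e_def
    proof (rule edge_choices_le)
      show "1 \<le> card A" using AW(3) finA[OF A] by (simp add: Suc_le_eq card_gt_0_iff)
      show "real (card A + card W) \<le> M" using card_mono[OF B(1) AW(2)] B(2) cAW by linarith
    qed (use AW q small in \<open>auto simp: P_def\<close>)
    finally show ?thesis .
  qed
  have cJ: "real (card (J A)) \<le> P ^ card A" if A: "A \<in> I" for A
  proof -
    have fa: "finite (anc A)" using finA[OF A] by (simp add: anc_def)
    have "card (J A) \<le> card (Pow (anc A))" using fa by (intro card_mono) (auto simp: J_def)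
    also have "\<dots> = 2 ^ card (anc A)" using fa by (simp add: card_Pow)
    also have "\<dots> \<le> 2 ^ ((r - 1) * card A)"
    proof (rule power_increasing)
      have "card (anc A) \<le> (\<Sum>a\<in>A. card (ancestors r \<pi> a))"
        unfolding anc_def using finA[OF A] by (rule card_UN_le)
      also have "\<dots> \<le> (\<Sum>a\<in>A. r - 1)" by (intro sum_mono card_ancestors_le)
      finally show "card (anc A) \<le> (r - 1) * card A" by (simp add: mult.commute)
    qed simp
    finally have "real (card (J A)) \<le> real (2 ^ ((r - 1) * card A))" by (rule of_nat_mono)
    then show ?thesis by (simp add: P_def power_mult)
  qed
  have "(\<Sum>F | leafy r B \<pi> F. q ^ card F) \<le> (\<Sum>F\<in>(\<Union>A\<in>I. \<Union>W\<in>J A. K A W). q ^ card F)"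
    using q by (intro sum_mono2 fin sub) auto
  also have "\<dots> \<le> (\<Sum>A\<in>I. \<Sum>F\<in>(\<Union>W\<in>J A. K A W). q ^ card F)"
    using q finI finJ finK by (intro sum_UNION_le) auto
  also have "\<dots> \<le> (\<Sum>A\<in>I. \<Sum>W\<in>J A. \<Sum>F\<in>K A W. q ^ card F)"
    using q finJ finK by (intro sum_mono sum_UNION_le) auto
  also have "\<dots> \<le> (\<Sum>A\<in>I. \<Sum>W\<in>J A. g (card A) / P ^ card A)"
    using inner by (intro sum_mono) auto
  also have "\<dots> \<le> (\<Sum>A\<in>I. g (card A))"
  proof (rule sum_mono)
    fix A assume "A \<in> I"
    then have "real (card (J A)) * (g (card A) / P ^ card A) \<le> P ^ card A * (g (card A) / P ^ card A)"
      using cJ g0 by (intro mult_right_mono) (auto simp: P_def)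
    then show "(\<Sum>W\<in>J A. g (card A) / P ^ card A) \<le> g (card A)" by (simp add: P_def)
  qed
  also have "\<dots> = (\<Sum>a=1..card B. \<Sum>A | A \<in> I \<and> card A = a. g (card A))"
  proof (rule sum.group[symmetric, OF finI])
    show "card ` I \<subseteq> {1..card B}"
    proof
      fix a assume "a \<in> card ` I"
      then obtain A where A: "A \<in> I" "a = card A" by blast
      then have "A \<noteq> {}" "card A \<le> card B" using card_mono[OF B(1)] by (auto simp: I_def)
      then show "a \<in> {1..card B}" using A finA[OF A(1)] by (simp add: Suc_le_eq card_gt_0_iff)
    qed
  qed simp
  also have "\<dots> \<le> (\<Sum>a=1..card B. 18 / M * (19 / 20) ^ a)"
  proof (rule sum_mono)
    fix a assume "a \<in> {1..card B}"
    have "card {A. A \<in> I \<and> card A = a} \<le> card {A. A \<subseteq> B \<and> card A = a}"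
      using B(1) by (intro card_mono) (auto simp: I_def)
    also have "\<dots> = card B choose a" using n_subsets[OF B(1)] by simp
    finally have "card {A. A \<in> I \<and> card A = a} * fact a \<le> card B ^ a"
      using binomial_fact_pow[of "card B" a] by (meson le_trans mult_le_mono1)
    then have "real (card {A. A \<in> I \<and> card A = a} * fact a) \<le> real (card B ^ a)"
      by (rule of_nat_mono)
    also have "\<dots> \<le> M ^ a" using B(2) by (simp add: power_mono)
    finally have "real (card {A. A \<in> I \<and> card A = a}) * fact a / M ^ a \<le> 1" using M by simp
    then have "real (card {A. A \<in> I \<and> card A = a}) * fact a / M ^ a * (18 * (19 / 20) ^ a / M)
        \<le> 1 * (18 * (19 / 20) ^ a / M)"
      using M by (intro mult_right_mono) auto
    then show "(\<Sum>A | A \<in> I \<and> card A = a. g (card A)) \<le> 18 / M * (19 / 20) ^ a"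
      by (simp add: g_def)
  qed
  also have "\<dots> = 18 / M * (\<Sum>a=1..card B. (19 / 20) ^ a)" by (simp add: sum_distrib_left)
  also have "\<dots> \<le> 18 / M * ((19 / 20) ^ 1 / (1 - 19 / 20))"
    using M by (intro mult_left_mono sum_geometric_le) auto
  also have "\<dots> \<le> 360 / M" using M by (simp add: field_simps)
  finally show "(\<Sum>F | leafy r B \<pi> F. q ^ card F) \<le> 360 / M" .
qed

section \<open>Degeneracy of the ball\<close>

lemma sum_Un_le:
  fixes f :: "'a \<Rightarrow> real"
  assumes "finite A" "finite B" "\<And>x. 0 \<le> f x"
  shows "sum f (A \<union> B) \<le> sum f A + sum f B"
proof -
  have "sum f (A \<union> B) = sum f A + sum f (B - A)"
    using sum.union_disjoint[of A "B - A" f] assms by (auto simp: Un_Diff_cancel)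
  also have "sum f (B - A) \<le> sum f B" using assms by (intro sum_mono2) auto
  finally show ?thesis by simp
qed

lemma exp_2_less: "exp 2 < (74 / 10 :: real)"
proof -
  have "exp 2 = (exp 1 :: real) ^ (2::nat)" by (simp add: exp_of_nat_mult[symmetric])
  also have "\<dots> < (272 / 100 :: real) ^ 2"
    using e_less_272 by (intro power_strict_mono) auto
  also have "\<dots> < 74 / 10" by (simp add: power2_eq_square)
  finally show ?thesis .
qed

text \<open>The bound for fixed parameters. Its three terms account for a vertex of degree above
  \<open>(1 + \<delta>) * \<mu>\<close>, for a cycle outside the tree, and for a \<^const>\<open>leafy\<close> set outside the tree. If no
  degree is too large, then \<open>M\<close> bounds the number of vertices of the ball.\<close>

lemma prob_not_degenerate_le:
  fixes n v r :: nat and p \<delta> \<mu> :: real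
  assumes r: "0 < r" and v: "v < n" and p: "0 < p" "p < 1" and \<delta>: "0 < \<delta>" and \<mu>: "real n * p \<le> \<mu>"
  defines "M \<equiv> (\<Sum>i\<le>r. ((1 + \<delta>) * \<mu>) ^ i)"
  assumes c: "M * (p / (1 - p)) \<le> 11 / 10 * (3 / 10) ^ (r + 1)"
  shows "measure_pmf.prob (erdos_renyi n p) {G. \<not> degenerate 2 (graph_ball r v G)}
    \<le> real n * exp (- \<mu> * ((1 + \<delta>) * ln (1 + \<delta>) - \<delta>)) + (1 / 500 + 360 / M)"
proof -
  define X where "X = all_pairs {..<n}"
  define q where "q = p / (1 - p)"
  define \<Delta> where "\<Delta> = (1 + \<delta>) * \<mu>"
  define s where "s = 1 / 500 + 360 / M"
  let ?bad = "{E \<in> Pow X. \<not> degenerate 2 (graph_ball r v ({..<n}, E))}"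
  let ?high = "\<lambda>x. {E \<in> Pow X. \<Delta> < real (card {e \<in> E. x \<in> e})}"
  let ?low = "{E \<in> ?bad. \<forall>x. real (card {e \<in> E. x \<in> e}) \<le> \<Delta>}"
  have finX: "finite X" by (simp add: X_def)
  have w0: "0 \<le> weight X p E" for E using p by (simp add: weight_nonneg)
  have "0 \<le> real n * p" using p by simp
  then have \<Delta>0: "0 \<le> \<Delta>" using \<mu> \<delta> by (simp add: \<Delta>_def)
  have M1: "1 \<le> M"
  proof -
    have "(\<Sum>i\<in>{0}. \<Delta> ^ i) \<le> M" unfolding M_def \<Delta>_def[symmetric]
      using \<Delta>0 by (intro sum_mono2) auto
    then show ?thesis by simp
  qed
  have q0: "0 \<le> q" using p by (simp add: q_def)
  have cq: "M * q \<le> 11 / 10 * (3 / 10) ^ (r + 1)" using c by (simp add: q_def)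
  have c99: "M * q \<le> 99 / 1000"
  proof -
    have "(3 / 10 :: real) ^ (r + 1) \<le> (3 / 10) ^ 2" using r by (intro power_decreasing) auto
    then show ?thesis using cq by (simp add: power2_eq_square)
  qed
  have s_cycles: "(M * q) ^ 3 / (1 - M * q) \<le> 1 / 500"
  proof -
    have "(M * q) ^ 3 / (1 - M * q) \<le> (99 / 1000) ^ 3 / (1 - 99 / 1000)"
      using c99 M1 q0 by (intro frac_le power_mono) auto
    also have "\<dots> \<le> 1 / 500" by (simp add: power3_eq_cube)
    finally show ?thesis .
  qed
  \<comment> \<open>For \<open>r = 2\<close> the upper bound obtained here is below \<open>0.88\<close>; raising \<open>r\<close> by one multiplies it by \<open>2 * 3 / 10\<close>.\<close>
  have small: "2 * exp 2 * (M * q) * 2 ^ (r - 1) \<le> 9 / 10" if "2 \<le> r"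
  proof -
    obtain k where k: "r = k + 2" using \<open>2 \<le> r\<close> le_Suc_ex by (metis add.commute)
    have "2 * exp 2 * (M * q) \<le> 2 * (74 / 10) * (11 / 10 * (3 / 10) ^ (r + 1))"
      by (rule mult_mono) (use exp_2_less cq M1 q0 in simp_all)
    then have "2 * exp 2 * (M * q) * 2 ^ (r - 1) \<le> 2 * (74 / 10) * (11 / 10 * (3 / 10) ^ (r + 1)) * 2 ^ (r - 1)"
      by (rule mult_right_mono) simp
    also have "\<dots> = 2 * (74 / 10) * (11 / 10) * (27 / 1000) * 2 * (6 / 10) ^ k"
      by (simp add: k power_add power_mult_distrib[symmetric] power3_eq_cube)
    also have "\<dots> \<le> 2 * (74 / 10) * (11 / 10) * (27 / 1000) * 2 * 1"
      by (intro mult_left_mono power_le_one) auto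
    finally show ?thesis by simp
  qed
  \<comment> \<open>The family depends on \<open>E\<close> only through the ball and its tree; it is empty for large balls, so that the
    bound on its weighted size holds for every \<open>E\<close>.\<close>
  define \<F> where "\<F> E = (let B = reach E v r; \<pi> = parent E v r in
      if real (card B) \<le> M then {F. (cyclic B F \<or> leafy r B \<pi> F) \<and> F \<inter> tree_edges B v \<pi> = {}} else {})" for E
  have fin_sum: "finite (\<F> E) \<and> (\<Sum>F\<in>\<F> E. q ^ card F) \<le> s" if E: "E \<subseteq> X" for E
  proof (cases "real (card (reach E v r)) \<le> M")
    case True
    define B where "B = reach E v r"
    define \<pi> where "\<pi> = parent E v r"
    have finB: "finite B" using reach_subset[of E "{..<n}" v r] E v finite_subset by (auto simp: X_def B_def)
    have B: "real (card B) \<le> M" using True by (simp add: B_def)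
    have "M * q < 1" using c99 by simp
    note cyclic = sum_cyclic_le[OF finB B q0 this]
    note cyc = cyclic(1) order_trans[OF cyclic(2) s_cycles]
    have lf: "finite {F. leafy r B \<pi> F} \<and> (\<Sum>F | leafy r B \<pi> F. q ^ card F) \<le> 360 / M"
    proof (cases "2 \<le> r")
      case True
      then show ?thesis using sum_leafy_le[OF finB B q0 _ small] M1 by auto
    next
      case False
      then have "{F. leafy r B \<pi> F} = {}" using leafy_height by auto
      then show ?thesis using M1 by simp
    qed
    have sub: "\<F> E \<subseteq> {F. cyclic B F} \<union> {F. leafy r B \<pi> F}"
      unfolding \<F>_def Let_def B_def \<pi>_def by auto
    have "(\<Sum>F\<in>\<F> E. q ^ card F) \<le> (\<Sum>F\<in>{F. cyclic B F} \<union> {F. leafy r B \<pi> F}. q ^ card F)"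
      using sub cyc lf q0 by (intro sum_mono2) auto
    also have "\<dots> \<le> (\<Sum>F | cyclic B F. q ^ card F) + (\<Sum>F | leafy r B \<pi> F. q ^ card F)"
      using cyc lf q0 by (intro sum_Un_le) auto
    also have "\<dots> \<le> s" using cyc lf by (simp add: s_def)
    finally show ?thesis using finite_subset[OF sub] cyc lf by simp
  next
    case False
    then have "\<F> E = {}" by (simp add: \<F>_def)
    then show ?thesis using M1 by (simp add: s_def)
  qed
  have "sum (weight X p) ?low \<le> s"
  proof (rule sum_weight_deletion[OF finX p])
    fix E assume "E \<in> ?low"
    then have E: "E \<subseteq> X" "\<not> degenerate 2 (graph_ball r v ({..<n}, E))"
      "\<And>x. real (card {e \<in> E. x \<in> e}) \<le> \<Delta>" by auto
    have EX: "E \<subseteq> all_pairs {..<n}" using E(1) by (simp add: X_def)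
    have "real (card (reach E v r)) \<le> M"
      using card_reach_le[OF finite_subset[OF E(1) finX] EX E(3), of v r] by (simp add: M_def \<Delta>_def)
    moreover obtain F where "F \<subseteq> E - tree_edges (reach E v r) v (parent E v r)"
      "cyclic (reach E v r) F \<or> leafy r (reach E v r) (parent E v r) F"
      using not_degenerate_structure[OF _ EX _ E(2)] v by auto
    ultimately have "F \<in> \<F> E" "F \<subseteq> E" unfolding \<F>_def Let_def by auto
    then show "E \<subseteq> X \<and> (\<exists>F \<subseteq> E. F \<in> \<F> E)" using E(1) by blast
  next
    fix E F assume "F \<in> \<F> E"
    then have "F \<inter> tree_edges (reach E v r) v (parent E v r) = {}"
      by (simp add: \<F>_def Let_def split: if_splits)
    from delete_non_tree_edges[OF this] show "\<F> (E - F) = \<F> E" by (simp add: \<F>_def)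
  qed (use fin_sum in \<open>auto simp: q_def\<close>)
  moreover have "sum (weight X p) (\<Union>x\<in>{..<n}. ?high x)
      \<le> real n * exp (- \<mu> * ((1 + \<delta>) * ln (1 + \<delta>) - \<delta>))"
  proof -
    have "sum (weight X p) (\<Union>x\<in>{..<n}. ?high x) \<le> (\<Sum>x<n. sum (weight X p) (?high x))"
      using finX w0 by (intro sum_UNION_le) auto
    also have "\<dots> \<le> (\<Sum>x<n. exp (- \<mu> * ((1 + \<delta>) * ln (1 + \<delta>) - \<delta>)))"
      unfolding X_def \<Delta>_def using p \<delta> \<mu> by (intro sum_mono sum_weight_degree_tail) auto
    finally show ?thesis by simp
  qed
  moreover have "sum (weight X p) ?bad \<le> sum (weight X p) ((\<Union>x\<in>{..<n}. ?high x) \<union> ?low)"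
  proof (rule sum_mono2)
    show "?bad \<subseteq> (\<Union>x\<in>{..<n}. ?high x) \<union> ?low"
    proof
      fix E assume E: "E \<in> ?bad"
      show "E \<in> (\<Union>x\<in>{..<n}. ?high x) \<union> ?low"
      proof (cases "\<exists>x<n. \<Delta> < real (card {e \<in> E. x \<in> e})")
        case True
        then show ?thesis using E by auto
      next
        case False
        have "real (card {e \<in> E. x \<in> e}) \<le> \<Delta>" for x
        proof (cases "x < n")
          case True
          then show ?thesis using False by auto
        next
          case False
          then have "{e \<in> E. x \<in> e} = {}" using E by (auto simp: X_def all_pairs_def)
          then show ?thesis using \<Delta>0 by (simp only: card.empty of_nat_0)
        qed
        then show ?thesis using E by auto
      qed
    qed
  qed (use finX w0 in auto)
  moreover have "sum (weight X p) ((\<Union>x\<in>{..<n}. ?high x) \<union> ?low)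
      \<le> sum (weight X p) (\<Union>x\<in>{..<n}. ?high x) + sum (weight X p) ?low"
    using finX w0 by (intro sum_Un_le) auto
  moreover have "measure_pmf.prob (erdos_renyi n p) {G. \<not> degenerate 2 (graph_ball r v G)}
      = sum (weight X p) ?bad"
    unfolding X_def using p by (intro prob_erdos_renyi) auto
  ultimately show ?thesis unfolding s_def by linarith
qed

lemma chernoff_exponent_pos:
  fixes \<delta> :: real
  assumes "0 < \<delta>"
  shows "0 < (1 + \<delta>) * ln (1 + \<delta>) - \<delta>"
proof -
  have "ln (inverse (1 + \<delta>)) < inverse (1 + \<delta>) - 1"
    using ln_le_minus_one[of "inverse (1 + \<delta>)"] ln_eq_minus_one[of "inverse (1 + \<delta>)"] assms
    by (cases "ln (inverse (1 + \<delta>)) = inverse (1 + \<delta>) - 1") auto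
  then have "(1 + \<delta>) * - ln (1 + \<delta>) < (1 + \<delta>) * (inverse (1 + \<delta>) - 1)"
    using assms by (intro mult_strict_left_mono) (auto simp: ln_inverse)
  also have "(1 + \<delta>) * (inverse (1 + \<delta>) - 1) = - \<delta>" using assms by (simp add: right_diff_distrib)
  finally show ?thesis by simp
qed

lemma prob_not_degenerate_eventually:
  fixes r :: nat
  assumes r: "0 < r"
  obtains N0 :: real where "\<And>N v. N0 \<le> N \<Longrightarrow> v < nat \<lfloor>N ^ (r + 1)\<rfloor> \<Longrightarrow>
    measure_pmf.prob (erdos_renyi (nat \<lfloor>N ^ (r + 1)\<rfloor>) (3 / 10 * N powi (- int r)))
      {G. \<not> degenerate 2 (graph_ball r v G)} \<le> 1 / 100"
proof -
  have "((\<lambda>\<delta>::real. (1 + \<delta>) ^ r) \<longlongrightarrow> (1 + 0) ^ r) (at_right 0)"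
    by (intro tendsto_intros)
  then have "\<forall>\<^sub>F \<delta> in at_right (0::real). (1 + \<delta>) ^ r < 21 / 20"
    by (rule order_tendstoD) simp
  moreover have "\<forall>\<^sub>F \<delta> in at_right (0::real). 0 < \<delta>" by (rule eventually_at_right_less)
  ultimately obtain \<delta> :: real where \<delta>: "0 < \<delta>" "(1 + \<delta>) ^ r < 21 / 20"
    using eventually_conj[THEN eventually_happens] trivial_limit_at_right_real by (metis (no_types, lifting))
  define \<kappa> where "\<kappa> = 3 / 10 * ((1 + \<delta>) * ln (1 + \<delta>) - \<delta>)"
  have \<kappa>: "0 < \<kappa>" using chernoff_exponent_pos[OF \<delta>(1)] by (simp add: \<kappa>_def)
  have lim: "((\<lambda>N. N ^ (r + 1) * exp (- \<kappa> * N) + 1200 / N) \<longlongrightarrow> 0) at_top"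
  proof -
    have "filterlim (\<lambda>N. \<kappa> * N) at_top at_top"
      using \<kappa> by (intro filterlim_tendsto_pos_mult_at_top[OF tendsto_const] filterlim_ident) auto
    then have "((\<lambda>N. (\<kappa> * N) ^ (r + 1) / exp (\<kappa> * N)) \<longlongrightarrow> 0) at_top"
      by (rule filterlim_compose[OF tendsto_power_div_exp_0])
    then have "((\<lambda>N. (\<kappa> * N) ^ (r + 1) / exp (\<kappa> * N) / \<kappa> ^ (r + 1)) \<longlongrightarrow> 0 / \<kappa> ^ (r + 1)) at_top"
      using \<kappa> by (intro tendsto_divide tendsto_const) auto
    moreover have "(\<kappa> * N) ^ (r + 1) / exp (\<kappa> * N) / \<kappa> ^ (r + 1) = N ^ (r + 1) * exp (- \<kappa> * N)" for N
      using \<kappa> by (simp add: power_mult_distrib exp_minus field_simps)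
    ultimately have "((\<lambda>N. N ^ (r + 1) * exp (- \<kappa> * N)) \<longlongrightarrow> 0) at_top" by simp
    moreover have "((\<lambda>N::real. 1200 / N) \<longlongrightarrow> 0) at_top"
      by (intro tendsto_divide_0[OF tendsto_const] filterlim_at_top_imp_at_infinity filterlim_ident)
    ultimately show ?thesis using tendsto_add[of _ 0 _ _ 0] by fastforce
  qed
  have "\<forall>\<^sub>F N in at_top. N ^ (r + 1) * exp (- \<kappa> * N) + 1200 / N < 1 / 200"
    using lim by (rule order_tendstoD) simp
  then obtain N1 where N1: "\<And>N. N1 \<le> N \<Longrightarrow> N ^ (r + 1) * exp (- \<kappa> * N) + 1200 / N < 1 / 200"
    by (auto simp: eventually_at_top_linorder)
  \<comment> \<open>For \<open>N \<ge> 150\<close> the two factors \<open>\<Delta> / (\<Delta> - 1)\<close> and \<open>1 / (1 - p)\<close> below are at most \<open>44 / 43\<close>, and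
    \<open>21 / 20 * (44 / 43)\<^sup>2 \<le> 11 / 10\<close>.\<close>
  show ?thesis
  proof (rule that[of "max N1 150"])
    fix N :: real and v :: nat
    define n where "n = nat \<lfloor>N ^ (r + 1)\<rfloor>"
    define p where "p = 3 / 10 * N powi (- int r)"
    define \<mu> where "\<mu> = 3 / 10 * N"
    define \<Delta> where "\<Delta> = (1 + \<delta>) * \<mu>"
    define M where "M = (\<Sum>i\<le>r. \<Delta> ^ i)"
    assume N: "max N1 150 \<le> N" and v: "v < nat \<lfloor>N ^ (r + 1)\<rfloor>"
    then have N150: "150 \<le> N" by simp
    have p_eq: "p = 3 / 10 / N ^ r" 
    proof -
      have "N powi (- int r) = inverse (N ^ r)" by (simp add: power_int_minus)
      then show ?thesis by (simp add: p_def inverse_eq_divide)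
    qed
    have "N ^ 1 \<le> N ^ r" using r N150 by (intro power_increasing) auto
    then have Nr: "150 \<le> N ^ r" using N150 by simp
    have p: "0 < p" "p \<le> 1 / 44" using Nr by (auto simp: p_eq field_simps)
    have n: "real n \<le> N ^ (r + 1)" using N150 by (simp add: n_def)
    have np: "real n * p \<le> \<mu>"
    proof -
      have "real n * p \<le> N ^ (r + 1) * p" using n p by (intro mult_right_mono) auto
      also have "\<dots> = \<mu>" using N150 by (simp add: p_eq \<mu>_def)
      finally show ?thesis .
    qed
    have \<mu>: "45 \<le> \<mu>" using N150 by (simp add: \<mu>_def)
    have \<Delta>\<mu>: "\<mu> \<le> \<Delta>" using \<mu> \<delta>(1) by (simp add: \<Delta>_def)
    have \<Delta>: "45 \<le> \<Delta>" using \<mu> \<Delta>\<mu> by simp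
    have M_lower: "\<mu> \<le> M"
    proof -
      have "(\<Sum>i\<in>{1}. \<Delta> ^ i) \<le> M" unfolding M_def using \<Delta> r by (intro sum_mono2) auto
      then show ?thesis using \<Delta>\<mu> by simp
    qed
    have M_upper: "M \<le> \<Delta> ^ r * (44 / 43)"
    proof -
      have "M = (\<Delta> ^ Suc r - 1) / (\<Delta> - 1)"
        unfolding M_def using geometric_sum[of \<Delta> "Suc r"] \<Delta> by (simp add: lessThan_Suc_atMost)
      also have "\<dots> \<le> \<Delta> ^ Suc r / (\<Delta> - 1)" using \<Delta> by (intro divide_right_mono) auto
      also have "\<dots> = \<Delta> ^ r * (\<Delta> / (\<Delta> - 1))" by simp
      also have "\<dots> \<le> \<Delta> ^ r * (44 / 43)" using \<Delta> by (intro mult_left_mono) (auto simp: field_simps)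
      finally show ?thesis .
    qed
    have \<Delta>_pow: "\<Delta> ^ r = (1 + \<delta>) ^ r * ((3 / 10) ^ r * N ^ r)"
      by (simp only: \<Delta>_def \<mu>_def power_mult_distrib)
    have c: "M * (p / (1 - p)) \<le> 11 / 10 * (3 / 10) ^ (r + 1)"
    proof -
      have "1 / (1 - p) \<le> 44 / 43" using p by (simp add: field_simps)
      then have "M * (p * (1 / (1 - p))) \<le> (\<Delta> ^ r * (44 / 43)) * (p * (44 / 43))"
        using p M_upper \<Delta> by (intro mult_mono) auto
      also have "\<dots> = (1 + \<delta>) ^ r * (44 / 43 * (44 / 43)) * (3 / 10) ^ (r + 1)"
        using N150 by (simp add: \<Delta>_pow p_eq)
      also have "\<dots> \<le> 21 / 20 * (44 / 43 * (44 / 43)) * (3 / 10) ^ (r + 1)"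
        using \<delta>(2) by (intro mult_right_mono) auto
      also have "\<dots> \<le> 11 / 10 * (3 / 10) ^ (r + 1)" by (intro mult_right_mono) auto
      finally show ?thesis by simp
    qed
    have "measure_pmf.prob (erdos_renyi n p) {G. \<not> degenerate 2 (graph_ball r v G)}
        \<le> real n * exp (- \<mu> * ((1 + \<delta>) * ln (1 + \<delta>) - \<delta>)) + (1 / 500 + 360 / M)"
      using prob_not_degenerate_le[OF r, of v n p \<delta> \<mu>] v p \<delta>(1) np c
      unfolding n_def[symmetric] M_def[symmetric] \<Delta>_def[symmetric] by simp
    moreover have "real n * exp (- \<mu> * ((1 + \<delta>) * ln (1 + \<delta>) - \<delta>)) \<le> N ^ (r + 1) * exp (- \<kappa> * N)"
    proof -
      have "- \<mu> * ((1 + \<delta>) * ln (1 + \<delta>) - \<delta>) = - \<kappa> * N" by (simp add: \<mu>_def \<kappa>_def)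
      then show ?thesis using n by (simp only:) (intro mult_right_mono, auto)
    qed
    moreover have "360 / M \<le> 360 / \<mu>" using M_lower \<mu> by (intro divide_left_mono) auto
    moreover have "360 / \<mu> = 1200 / N" by (simp add: \<mu>_def)
    moreover have "N ^ (r + 1) * exp (- \<kappa> * N) + 1200 / N < 1 / 200" using N1 N by simp
    ultimately have "measure_pmf.prob (erdos_renyi n p) {G. \<not> degenerate 2 (graph_ball r v G)} \<le> 1 / 100"
      by linarith
    then show "measure_pmf.prob (erdos_renyi (nat \<lfloor>N ^ (r + 1)\<rfloor>) (3 / 10 * N powi (- int r)))
      {G. \<not> degenerate 2 (graph_ball r v G)} \<le> 1 / 100" by (simp only: n_def p_def)
  qed
qed

theorem theorem5p2:
  fixes r :: nat
  assumes "r > 0"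
  shows "\<exists>err :: nat \<Rightarrow> real. err \<longlonglongrightarrow> 0 \<and>
    (\<forall>l::nat. l > 0 \<longrightarrow>
      (let D = 10 * real l * ln (real l);
           n = nat \<lfloor>D ^ (r + 1)\<rfloor>;
           p = 3 / 10 * D powi (- int r)
       in \<forall>v \<in> {..<n}.
            measure_pmf.prob (erdos_renyi n p) {G. degenerate 2 (graph_ball r v G)}
              \<ge> 99 / 100 - err l))"
proof -
  obtain N0 :: real where N0: "\<And>N v. N0 \<le> N \<Longrightarrow> v < nat \<lfloor>N ^ (r + 1)\<rfloor> \<Longrightarrow>
    measure_pmf.prob (erdos_renyi (nat \<lfloor>N ^ (r + 1)\<rfloor>) (3 / 10 * N powi (- int r)))
      {G. \<not> degenerate 2 (graph_ball r v G)} \<le> 1 / 100"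
    using prob_not_degenerate_eventually[OF assms] by blast
  define D where "D l = 10 * real l * ln (real l)" for l :: nat
  \<comment> \<open>The failure probability is eventually below \<open>1 / 100\<close>, so the error term can be taken to vanish
    eventually; the value \<open>1\<close> makes the bound trivial before that.\<close>
  define err :: "nat \<Rightarrow> real" where "err l = (if N0 \<le> D l then 0 else 1)" for l
  have "filterlim D at_top sequentially"
    unfolding D_def
    by (intro filterlim_at_top_mult_at_top filterlim_tendsto_pos_mult_at_top[OF tendsto_const]
        filterlim_real_sequentially filterlim_compose[OF ln_at_top]) auto
  then have "\<forall>\<^sub>F l in sequentially. N0 \<le> D l" by (simp add: filterlim_at_top)
  then have "\<forall>\<^sub>F l in sequentially. err l = 0" by eventually_elim (simp add: err_def)
  then have "err \<longlonglongrightarrow> 0" by (rule tendsto_eventually)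
  moreover have "99 / 100 - err l \<le> measure_pmf.prob (erdos_renyi n p) {G. degenerate 2 (graph_ball r v G)}"
    if "n = nat \<lfloor>D l ^ (r + 1)\<rfloor>" "p = 3 / 10 * D l powi (- int r)" "v < n" for l n p v
  proof (cases "N0 \<le> D l")
    case True
    have "{G. \<not> degenerate 2 (graph_ball r v G)} = UNIV - {G. degenerate 2 (graph_ball r v G)}" by auto
    then have "measure_pmf.prob (erdos_renyi n p) {G. \<not> degenerate 2 (graph_ball r v G)}
      = 1 - measure_pmf.prob (erdos_renyi n p) {G. degenerate 2 (graph_ball r v G)}"
      using measure_pmf.prob_compl[of "{G. degenerate 2 (graph_ball r v G)}" "erdos_renyi n p"] by simp
    moreover have "measure_pmf.prob (erdos_renyi n p) {G. \<not> degenerate 2 (graph_ball r v G)} \<le> 1 / 100"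
      using N0[OF True, of v] that(3) unfolding that(1,2)[symmetric] by blast
    ultimately show ?thesis using True by (simp add: err_def)
  next
    case False
    have "0 \<le> measure_pmf.prob (erdos_renyi n p) {G. degenerate 2 (graph_ball r v G)}"
      by (rule measure_nonneg)
    then show ?thesis using False by (simp only: err_def if_False)
  qed
  ultimately show ?thesis
    unfolding Let_def D_def[symmetric] by (intro exI[of _ err]) auto
qed

end
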